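(* Consider the equation $w_xE_x+w_yE_y+E(w_{xx}+w_{yy})=-1$ with $w=w(x,y)$ and $E=E(x,y)$ both dependent variables, and a nonclassical generator $\mathcal U=\xi\,\partial_x+\partial_y+\phi\,\partial_w+\psi\,\partial_E$ of this equation with $\xi=A(x,y)$ and $\phi=G(x,y,w)$. If $A\not\equiv 0$ is a solution of the equation $$(A^4-1)A_{xx}+4A(A^2+1)A_{xy}-(A^4-1)A_{yy}-2A(A^2-3)A_x^2-4(3A^2-1)A_xA_y+2A(A^2-3)A_y^2=0$$ and $G\equiv 0$, then the nonclassical generator is $$\mathcal U=A(x,y)\,\partial_x+\partial_y+\frac{2(A_x-AA_y)}{A^2+1}\,E\,\partial_E .$$
   Context: All functions are assumed real analytic on open domains, and $E\neq 0$. Put $F=w_xE_x+w_yE_y+E(w_{xx}+w_{yy})+1$ on the second-order jet space with independent variables $x,y$ and dependent variables $w,E$. For a vector field $\mathcal U=\xi\,\partial_x+\partial_y+\phi\,\partial_w+\psi\,\partial_E$ with $\xi,\phi,\psi$ functions of $(x,y,w,E)$ (the coefficient of $\partial_y$ is normalized to $1$), put $\phi_1=\xi w_x+w_y-\phi$ and $\phi_2=\xi E_x+E_y-\psi$. $\mathcal U$ is called a nonclassical generator (generator of a nonclassical equivalence transformation, or conditional symmetry) of the equation $F=0$ if $\mathrm{pr}^{(2)}\mathcal U(F)=0$, $\mathrm{pr}^{(1)}\mathcal U(\phi_1)=0$ and $\mathrm{pr}^{(1)}\mathcal U(\phi_2)=0$ at all jet points where $F=0$, $\phi_1=\phi_2=0$,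 and the total derivatives of $\phi_1,\phi_2$ with respect to $x$ and $y$ vanish. Here $\mathrm{pr}^{(n)}\mathcal U$ is the usual $n$-th prolongation ($x,y$ independent, $w,E$ dependent). A statement that "the nonclassical generator" with prescribed $\xi$ and $\phi$ is a given vector field means that this vector field is a nonclassical generator and is the one with those $\xi,\phi$. *)

theory Defs
  imports "HOL-Analysis.Analysis"
begin

text \<open>Local expansion into an (unconditionally) convergent power series; multi-indices are the
  functions from the standard basis to the natural numbers.\<close>

definition real_analytic_at :: "('a::euclidean_space \<Rightarrow> real) \<Rightarrow> 'a \<Rightarrow> bool" where
  "real_analytic_at f a \<longleftrightarrow>
     (\<exists>r>0. \<exists>c :: ('a \<Rightarrow> nat) \<Rightarrow> real. \<forall>x\<in>ball a r.
        ((\<lambda>\<alpha>. c \<alpha> * (\<Prod>b\<in>Basis. ((x - a) \<bullet> b) ^ \<alpha> b)) has_sum f x) (Basis \<rightarrow>\<^sub>E UNIV))"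

definition real_analytic_on :: "('a::euclidean_space \<Rightarrow> real) \<Rightarrow> 'a set \<Rightarrow> bool" where
  "real_analytic_on f S \<longleftrightarrow> (\<forall>a\<in>S. real_analytic_at f a)"

definition pdx :: "(real \<times> real \<Rightarrow> real) \<Rightarrow> real \<times> real \<Rightarrow> real" where
  "pdx f = (\<lambda>(x, y). deriv (\<lambda>t. f (t, y)) x)"

definition pdy :: "(real \<times> real \<Rightarrow> real) \<Rightarrow> real \<times> real \<Rightarrow> real" where
  "pdy f = (\<lambda>(x, y). deriv (\<lambda>t. f (x, t)) y)"

datatype dep = Dep_w | Dep_E

text \<open>\<open>Jet d i k\<close> is the coordinate of the derivative of the dependent variable \<open>d\<close>,
  taken \<open>i\<close> times in \<open>x\<close> and \<open>k\<close> times in \<open>y\<close>. A jet assigns values to the coordinates of all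
  orders; a function on the \<open>n\<close>-th order jet space is one that only depends on the coordinates
  with \<open>i + k \<le> n\<close>.\<close>

datatype jet_coord = Coord_x | Coord_y | Jet dep nat nat

type_synonym jet = "jet_coord \<Rightarrow> real"

type_synonym point = "real \<times> real \<times> real \<times> real"   \<comment> \<open>\<open>(x, y, w, E)\<close>\<close>

definition base :: "jet \<Rightarrow> point" where
  "base j = (j Coord_x, j Coord_y, j (Jet Dep_w 0 0), j (Jet Dep_E 0 0))"

definition jpd :: "jet_coord \<Rightarrow> (jet \<Rightarrow> real) \<Rightarrow> jet \<Rightarrow> real" where
  "jpd c f j = deriv (\<lambda>t. f (j(c := t))) (j c)"

text \<open>For functions on the \<open>n\<close>-th order jet space; the result lives in order \<open>n + 1\<close>.\<close>

definition total_dx :: "nat \<Rightarrow> (jet \<Rightarrow> real) \<Rightarrow> jet \<Rightarrow> real" where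
  "total_dx n f j = jpd Coord_x f j +
     (\<Sum>d\<in>{Dep_w, Dep_E}. \<Sum>(i, k)\<in>{(i, k). i + k \<le> n}. j (Jet d (Suc i) k) * jpd (Jet d i k) f j)"

definition total_dy :: "nat \<Rightarrow> (jet \<Rightarrow> real) \<Rightarrow> jet \<Rightarrow> real" where
  "total_dy n f j = jpd Coord_y f j +
     (\<Sum>d\<in>{Dep_w, Dep_E}. \<Sum>(i, k)\<in>{(i, k). i + k \<le> n}. j (Jet d i (Suc k)) * jpd (Jet d i k) f j)"

record vector_field =
  xi :: "point \<Rightarrow> real"             \<comment> \<open>coefficient of \<open>\<partial>\<^sub>x\<close>\<close>
  eta :: "point \<Rightarrow> real"            \<comment> \<open>coefficient of \<open>\<partial>\<^sub>y\<close>\<close>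
  coeff :: "dep \<Rightarrow> point \<Rightarrow> real"   \<comment> \<open>coefficients of \<open>\<partial>\<^sub>w\<close> and \<open>\<partial>\<^sub>E\<close>\<close>

text \<open>\<open>\<phi>\<^bsup>J,x\<^esup> = D\<^sub>x \<phi>\<^bsup>J\<^esup> - u\<^bsub>J,x\<^esub> D\<^sub>x \<xi> - u\<^bsub>J,y\<^esub> D\<^sub>x \<eta>\<close>, and likewise for \<open>y\<close>.\<close>

fun pr_coeff :: "vector_field \<Rightarrow> dep \<Rightarrow> nat \<Rightarrow> nat \<Rightarrow> jet \<Rightarrow> real" where
  "pr_coeff V d 0 0 = (\<lambda>j. coeff V d (base j))"
| "pr_coeff V d 0 (Suc k) = (\<lambda>j. total_dy k (pr_coeff V d 0 k) j
     - j (Jet d 1 k) * total_dy 0 (\<lambda>j. xi V (base j)) j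
     - j (Jet d 0 (Suc k)) * total_dy 0 (\<lambda>j. eta V (base j)) j)"
| "pr_coeff V d (Suc i) k = (\<lambda>j. total_dx (i + k) (pr_coeff V d i k) j
     - j (Jet d (Suc i) k) * total_dx 0 (\<lambda>j. xi V (base j)) j
     - j (Jet d i (Suc k)) * total_dx 0 (\<lambda>j. eta V (base j)) j)"

definition prolong :: "nat \<Rightarrow> vector_field \<Rightarrow> (jet \<Rightarrow> real) \<Rightarrow> jet \<Rightarrow> real" where
  "prolong n V f j = xi V (base j) * jpd Coord_x f j + eta V (base j) * jpd Coord_y f j +
     (\<Sum>d\<in>{Dep_w, Dep_E}. \<Sum>(i, k)\<in>{(i, k). i + k \<le> n}. pr_coeff V d i k j * jpd (Jet d i k) f j)"

definition inv_surface :: "vector_field \<Rightarrow> dep \<Rightarrow> jet \<Rightarrow> real" where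
  "inv_surface V d j =
     xi V (base j) * j (Jet d 1 0) + eta V (base j) * j (Jet d 0 1) - coeff V d (base j)"

definition F :: "jet \<Rightarrow> real" where
  "F j = j (Jet Dep_w 1 0) * j (Jet Dep_E 1 0) + j (Jet Dep_w 0 1) * j (Jet Dep_E 0 1)
     + j (Jet Dep_E 0 0) * (j (Jet Dep_w 2 0) + j (Jet Dep_w 0 2)) + 1"

definition normalized_field ::
  "(point \<Rightarrow> real) \<Rightarrow> (point \<Rightarrow> real) \<Rightarrow> (point \<Rightarrow> real) \<Rightarrow> vector_field" where
  "normalized_field \<xi> \<phi> \<psi> =
     \<lparr>xi = \<xi>, eta = (\<lambda>_. 1), coeff = (\<lambda>d. case d of Dep_w \<Rightarrow> \<phi> | Dep_E \<Rightarrow> \<psi>)\<rparr>"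

text \<open>The coefficients are only relevant on \<open>\<Omega>\<close>, which is meant to be open and disjoint
  from \<open>E = 0\<close>; this definition does not require it.\<close>

definition nonclassical_generator ::
  "point set \<Rightarrow> (point \<Rightarrow> real) \<Rightarrow> (point \<Rightarrow> real) \<Rightarrow> (point \<Rightarrow> real) \<Rightarrow> bool" where
  "nonclassical_generator \<Omega> \<xi> \<phi> \<psi> \<longleftrightarrow>
     real_analytic_on \<xi> \<Omega> \<and> real_analytic_on \<phi> \<Omega> \<and> real_analytic_on \<psi> \<Omega> \<and>
     (let V = normalized_field \<xi> \<phi> \<psi>; \<phi>\<^sub>1 = inv_surface V Dep_w; \<phi>\<^sub>2 = inv_surface V Dep_E in
      \<forall>j. base j \<in> \<Omega> \<and> F j = 0 \<and> \<phi>\<^sub>1 j = 0 \<and> \<phi>\<^sub>2 j = 0 \<and>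
          total_dx 1 \<phi>\<^sub>1 j = 0 \<and> total_dy 1 \<phi>\<^sub>1 j = 0 \<and>
          total_dx 1 \<phi>\<^sub>2 j = 0 \<and> total_dy 1 \<phi>\<^sub>2 j = 0 \<longrightarrow>
        prolong 2 V F j = 0 \<and> prolong 1 V \<phi>\<^sub>1 j = 0 \<and> prolong 1 V \<phi>\<^sub>2 j = 0)"

end

theory Submission imports Defs "HOL-Real_Asymp.Real_Asymp" begin

text \<open>
  On the invariant surface \<open>A w\<^sub>x + w\<^sub>y = 0\<close>, \<open>A E\<^sub>x + E\<^sub>y = \<psi>\<close> the equations
  for \<open>\<phi>\<^sub>1\<close> and \<open>\<phi>\<^sub>2\<close> are automatic, and all jet coordinates in \<open>pr\<^sup>2 U (F)\<close> can be
  expressed by \<open>w\<^sub>x\<close>, \<open>w\<^sub>x\<^sub>x\<close>, \<open>E\<^sub>x\<close> and \<open>E\<close>. At \<open>w\<^sub>x = 0\<close> what remains is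
  \<open>w\<^sub>x\<^sub>x ((A\<^sup>2 + 1) \<psi> - 2 (A\<^sub>x - A A\<^sub>y) E)\<close>, where \<open>F = 0\<close> prevents \<open>w\<^sub>x\<^sub>x\<close> from
  vanishing; this determines \<open>\<psi>\<close>. With that \<open>\<psi> = P E\<close>, the only further term is
  \<open>w\<^sub>x E\<close> times an expression in \<open>A\<close> and \<open>P\<close> that becomes, after multiplication by
  \<open>-(A\<^sup>2 + 1)\<^sup>2\<close>, the left-hand side of the equation assumed for \<open>A\<close>.

  Analyticity of \<open>\<psi>\<close> rests on the functions whose Taylor series at a point converges absolutely on
  a fixed cube: they form a Banach algebra under the weighted \<open>l\<^sup>1\<close> norm of the coefficients.
\<close>

section \<open>Convergent power series in several variables\<close>

text \<open>Analyticity of the three coefficients is part of being a generator, so a quotient of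
  derivatives of \<open>A\<close> must be shown analytic from the series definition. Cubes replace
  balls because at the corner of a cube every monomial equals \<rho> to its degree: convergence
  there is already absolute convergence with these weights, and one weighted sum controls values,
  products and geometric series. The series also yield \<open>pdx (pdy A) = pdy (pdx A)\<close>,
  which matters because the equation assumed for \<open>A\<close> has the mixed derivative in one
  order while differentiating \<psi> in x produces the other. On the jet side, \<xi> and \<phi> are
  prescribed only over the open set \<Omega>, and \<open>deriv\<close> obeys the product rule only
  where the factors are differentiable. Hence functions are exchanged for ones agreeing over
  \<Omega> before they are differentiated, and differentiability is carried along. No differential
  equation has to be solved for \<psi>: on the invariant surface w_x = 0 forces w_y = 0, and then no
  derivative of \<psi> is left in the prolonged equation.\<close>

abbreviation multi_indices :: "('a::euclidean_space \<Rightarrow> nat) set" where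
  "multi_indices \<equiv> Basis \<rightarrow>\<^sub>E UNIV"

definition total_degree :: "('a::euclidean_space \<Rightarrow> nat) \<Rightarrow> nat" where
  "total_degree \<alpha> = (\<Sum>b\<in>Basis. \<alpha> b)"

definition monomial :: "('a::euclidean_space \<Rightarrow> nat) \<Rightarrow> 'a \<Rightarrow> real" where
  "monomial \<alpha> y = (\<Prod>b\<in>Basis. (y \<bullet> b) ^ \<alpha> b)"

definition cube :: "'a::euclidean_space \<Rightarrow> real \<Rightarrow> 'a set" where
  "cube a \<rho> = {x. \<forall>b\<in>Basis. \<bar>(x - a) \<bullet> b\<bar> \<le> \<rho>}"

definition expands ::
  "'a::euclidean_space \<Rightarrow> real \<Rightarrow> (('a \<Rightarrow> nat) \<Rightarrow> real) \<Rightarrow> ('a \<Rightarrow> real) \<Rightarrow> bool" where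
  "expands a \<rho> c f \<longleftrightarrow> (\<lambda>\<alpha>. \<bar>c \<alpha>\<bar> * \<rho> ^ total_degree \<alpha>) summable_on multi_indices \<and>
     (\<forall>x\<in>cube a \<rho>. ((\<lambda>\<alpha>. c \<alpha> * monomial \<alpha> (x - a)) has_sum f x) multi_indices)"

text \<open>A relation instead of a norm: with the coefficients under an existential quantifier,
  bounds can be combined without knowing that a function determines its coefficients.\<close>

definition series_norm_le :: "'a::euclidean_space \<Rightarrow> real \<Rightarrow> ('a \<Rightarrow> real) \<Rightarrow> real \<Rightarrow> bool" where
  "series_norm_le a \<rho> f K \<longleftrightarrow>
     (\<exists>c. expands a \<rho> c f \<and> (\<Sum>\<^sub>\<infinity>\<alpha>\<in>multi_indices. \<bar>c \<alpha>\<bar> * \<rho> ^ total_degree \<alpha>) \<le> K)"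

lemma abs_monomial_le:
  assumes "x \<in> cube a \<rho>"
  shows "\<bar>monomial \<alpha> (x - a)\<bar> \<le> \<rho> ^ total_degree \<alpha>"
proof -
  have "\<bar>monomial \<alpha> (x - a)\<bar> = (\<Prod>b\<in>Basis. \<bar>(x - a) \<bullet> b\<bar> ^ \<alpha> b)"
    by (simp add: monomial_def abs_prod power_abs)
  also have "\<dots> \<le> (\<Prod>b\<in>Basis. \<rho> ^ \<alpha> b)"
    using assms by (intro prod_mono conjI power_mono) (auto simp: cube_def)
  finally show ?thesis by (simp add: total_degree_def power_sum)
qed

lemma center_in_cube: "0 \<le> \<rho> \<Longrightarrow> a \<in> cube a \<rho>"
  by (simp add: cube_def)

lemma cube_mono: "\<sigma> \<le> \<rho> \<Longrightarrow> cube a \<sigma> \<subseteq> cube a \<rho>"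
  by (force simp: cube_def)

lemma ball_subset_cube: "ball a \<rho> \<subseteq> cube a \<rho>"
proof
  fix x assume "x \<in> ball a \<rho>"
  hence "norm (x - a) < \<rho>" by (simp add: dist_norm norm_minus_commute)
  thus "x \<in> cube a \<rho>"
    unfolding cube_def by (auto intro: order_trans[OF Basis_le_norm])
qed

lemma expands_summable:
  assumes "expands a \<rho> c f" "x \<in> cube a \<rho>"
  shows "(\<lambda>\<alpha>. norm (c \<alpha> * monomial \<alpha> (x - a))) summable_on multi_indices"
  using assms(1) unfolding expands_def
  by (intro Infinite_Sum.abs_summable_on_comparison_test'[of "\<lambda>\<alpha>. \<bar>c \<alpha>\<bar> * \<rho> ^ total_degree \<alpha>"])
     (auto simp: abs_mult intro!: mult_left_mono abs_monomial_le assms(2))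

lemma series_norm_le_bound:
  assumes "series_norm_le a \<rho> f K" "x \<in> cube a \<rho>"
  shows "\<bar>f x\<bar> \<le> K"
proof -
  obtain c where c: "expands a \<rho> c f"
    and K: "(\<Sum>\<^sub>\<infinity>\<alpha>\<in>multi_indices. \<bar>c \<alpha>\<bar> * \<rho> ^ total_degree \<alpha>) \<le> K"
    using assms(1) by (auto simp: series_norm_le_def)
  have "f x = (\<Sum>\<^sub>\<infinity>\<alpha>\<in>multi_indices. c \<alpha> * monomial \<alpha> (x - a))"
    using c assms(2) by (auto simp: expands_def infsumI)
  also have "\<bar>\<dots>\<bar> \<le> (\<Sum>\<^sub>\<infinity>\<alpha>\<in>multi_indices. \<bar>c \<alpha> * monomial \<alpha> (x - a)\<bar>)"
    using norm_infsum_bound[OF expands_summable[OF c assms(2)]] by simp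
  also have "\<dots> \<le> (\<Sum>\<^sub>\<infinity>\<alpha>\<in>multi_indices. \<bar>c \<alpha>\<bar> * \<rho> ^ total_degree \<alpha>)"
    using expands_summable[OF c assms(2)] c
    by (intro infsum_mono)
       (auto simp: expands_def abs_mult intro!: mult_left_mono abs_monomial_le assms(2))
  finally show ?thesis using K by simp
qed

lemma series_norm_le_nonneg: "series_norm_le a \<rho> f K \<Longrightarrow> 0 \<le> \<rho> \<Longrightarrow> 0 \<le> K"
  using series_norm_le_bound[OF _ center_in_cube] abs_ge_zero order_trans by blast

text \<open>The family may repeat monomials: products and infinite sums of series arise in this form.\<close>

lemma series_norm_le_regroup:
  fixes e :: "'j \<Rightarrow> real" and \<pi> :: "'j \<Rightarrow> 'a::euclidean_space \<Rightarrow> nat"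
  assumes "0 < \<rho>" and \<pi>: "\<And>j. j \<in> J \<Longrightarrow> \<pi> j \<in> multi_indices"
    and sum: "(\<lambda>j. \<bar>e j\<bar> * \<rho> ^ total_degree (\<pi> j)) summable_on J"
    and le: "(\<Sum>\<^sub>\<infinity>j\<in>J. \<bar>e j\<bar> * \<rho> ^ total_degree (\<pi> j)) \<le> K"
    and f: "\<And>x. x \<in> cube a \<rho> \<Longrightarrow> ((\<lambda>j. e j * monomial (\<pi> j) (x - a)) has_sum f x) J"
  shows "series_norm_le a \<rho> f K"
proof -
  define B where "B \<gamma> = {j\<in>J. \<pi> j = \<gamma>}" for \<gamma>
  define c where "c \<gamma> = infsum e (B \<gamma>)" for \<gamma>
  \<comment> \<open>The projection \<open>snd\<close> identifies the disjoint union of the fibres of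
    \<open>\<pi>\<close> with \<open>J\<close>, so that both the values and the weights can be
    summed fibre by fibre with \<open>has_sum_SigmaD\<close>.\<close>
  have J: "J = snd ` (Sigma multi_indices B)"
  proof (intro equalityI subsetI)
    fix j assume "j \<in> J"
    hence "(\<pi> j, j) \<in> Sigma multi_indices B" using \<pi> by (simp add: B_def)
    thus "j \<in> snd ` (Sigma multi_indices B)" by (rule rev_image_eqI) simp
  qed (auto simp: B_def)
  have inj: "inj_on snd (Sigma multi_indices B)"
    by (auto simp: inj_on_def B_def)
  have sumB: "(\<lambda>j. \<bar>e j\<bar>) summable_on B \<gamma>" for \<gamma>
  proof -
    have "(\<lambda>j. \<bar>e j\<bar> * \<rho> ^ total_degree (\<pi> j)) summable_on B \<gamma>"
      using sum by (rule summable_on_subset) (auto simp: B_def)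
    hence "(\<lambda>j. \<bar>e j\<bar> * \<rho> ^ total_degree \<gamma>) summable_on B \<gamma>"
      by (rule summable_on_cong[THEN iffD1, rotated]) (auto simp: B_def)
    hence "(\<lambda>j. \<bar>e j\<bar> * \<rho> ^ total_degree \<gamma> * (1 / \<rho> ^ total_degree \<gamma>)) summable_on B \<gamma>"
      by (rule summable_on_cmult_left)
    thus ?thesis using \<open>0 < \<rho>\<close> by simp
  qed
  have eB: "(e has_sum c \<gamma>) (B \<gamma>)" for \<gamma>
    unfolding c_def by (rule has_sum_infsum, rule abs_summable_summable) (simp add: sumB)
  have val: "((\<lambda>\<gamma>. c \<gamma> * monomial \<gamma> (x - a)) has_sum f x) multi_indices"
    if "x \<in> cube a \<rho>" for x
  proof -
    have "((\<lambda>p. e (snd p) * monomial (\<pi> (snd p)) (x - a)) has_sum f x) (Sigma multi_indices B)"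
      using f[OF that] unfolding J has_sum_reindex[OF inj] by (simp add: o_def)
    thus ?thesis
    proof (rule has_sum_SigmaD)
      fix \<gamma> :: "'a \<Rightarrow> nat"
      have "((\<lambda>j. e j * monomial \<gamma> (x - a)) has_sum c \<gamma> * monomial \<gamma> (x - a)) (B \<gamma>)"
        by (intro has_sum_cmult_left eB)
      thus "((\<lambda>j. e (snd (\<gamma>, j)) * monomial (\<pi> (snd (\<gamma>, j))) (x - a)) has_sum
              c \<gamma> * monomial \<gamma> (x - a)) (B \<gamma>)"
        by (rule has_sum_cong[THEN iffD1, rotated]) (auto simp: B_def)
    qed
  qed
  define C where "C \<gamma> = (\<Sum>\<^sub>\<infinity>j\<in>B \<gamma>. \<bar>e j\<bar>) * \<rho> ^ total_degree \<gamma>" for \<gamma>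
  have C: "(C has_sum (\<Sum>\<^sub>\<infinity>j\<in>J. \<bar>e j\<bar> * \<rho> ^ total_degree (\<pi> j))) multi_indices"
  proof -
    have "((\<lambda>p. \<bar>e (snd p)\<bar> * \<rho> ^ total_degree (\<pi> (snd p))) has_sum
            (\<Sum>\<^sub>\<infinity>j\<in>J. \<bar>e j\<bar> * \<rho> ^ total_degree (\<pi> j))) (Sigma multi_indices B)"
      using has_sum_infsum[OF sum] has_sum_reindex[OF inj, of "\<lambda>j. \<bar>e j\<bar> * \<rho> ^ total_degree (\<pi> j)"]
      by (simp add: o_def flip: J)
    thus ?thesis
    proof (rule has_sum_SigmaD)
      fix \<gamma> :: "'a \<Rightarrow> nat"
      have "((\<lambda>j. \<bar>e j\<bar> * \<rho> ^ total_degree \<gamma>) has_sum C \<gamma>) (B \<gamma>)"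
        unfolding C_def by (intro has_sum_cmult_left has_sum_infsum sumB)
      thus "((\<lambda>j. \<bar>e (snd (\<gamma>, j))\<bar> * \<rho> ^ total_degree (\<pi> (snd (\<gamma>, j)))) has_sum C \<gamma>) (B \<gamma>)"
        by (rule has_sum_cong[THEN iffD1, rotated]) (auto simp: B_def)
    qed
  qed
  have cC: "\<bar>c \<gamma>\<bar> * \<rho> ^ total_degree \<gamma> \<le> C \<gamma>" for \<gamma>
    using norm_infsum_bound[of e "B \<gamma>"] sumB[of \<gamma>] \<open>0 < \<rho>\<close>
    by (auto simp: c_def C_def intro!: mult_right_mono)
  have csum: "(\<lambda>\<gamma>. \<bar>c \<gamma>\<bar> * \<rho> ^ total_degree \<gamma>) summable_on multi_indices"
    by (rule summable_on_comparison_test[OF has_sum_imp_summable[OF C] cC]) (use \<open>0 < \<rho>\<close> in simp)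
  have "(\<Sum>\<^sub>\<infinity>\<gamma>\<in>multi_indices. \<bar>c \<gamma>\<bar> * \<rho> ^ total_degree \<gamma>) \<le> K"
    by (rule order_trans[OF has_sum_mono[OF has_sum_infsum[OF csum] C cC] le])
  thus ?thesis unfolding series_norm_le_def expands_def using csum val by (intro exI[of _ c]) simp
qed

text \<open>Completeness of the weighted space, obtained by regrouping the double family indexed by
  pairs (k, \<alpha>). With an arbitrary index set it covers binary sums (index type
  \<open>bool\<close>), products, the geometric series and substitution of coordinates.\<close>

lemma series_norm_le_has_sum:
  assumes "0 < \<rho>" and g: "\<And>k. k \<in> S \<Longrightarrow> series_norm_le a \<rho> (g k) (N k)"
    and N: "N summable_on S" "infsum N S \<le> K"
    and f: "\<And>x. x \<in> cube a \<rho> \<Longrightarrow> ((\<lambda>k. g k x) has_sum f x) S"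
  shows "series_norm_le a \<rho> f K"
proof -
  obtain c where c: "\<And>k. k \<in> S \<Longrightarrow> expands a \<rho> (c k) (g k)"
    and cN: "\<And>k. k \<in> S \<Longrightarrow> (\<Sum>\<^sub>\<infinity>\<alpha>\<in>multi_indices. \<bar>c k \<alpha>\<bar> * \<rho> ^ total_degree \<alpha>) \<le> N k"
    using g unfolding series_norm_le_def by metis
  \<comment> \<open>\<open>N\<close> only bounds the norms from above; the double sum needs the
    exact weighted sum of each inner series, whose summability over \<open>S\<close> follows by
    comparison with \<open>N\<close>.\<close>
  define M where "M k = (\<Sum>\<^sub>\<infinity>\<alpha>\<in>multi_indices. \<bar>c k \<alpha>\<bar> * \<rho> ^ total_degree \<alpha>)" for k
  have cM: "((\<lambda>\<alpha>. \<bar>c k \<alpha>\<bar> * \<rho> ^ total_degree \<alpha>) has_sum M k) multi_indices" if "k \<in> S" for k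
    using c[OF that] by (auto simp: expands_def M_def)
  have M0: "M k \<ge> 0" for k
    using \<open>0 < \<rho>\<close> unfolding M_def by (intro infsum_nonneg) auto
  have Msum: "M summable_on S"
    using cN M0 by (intro summable_on_comparison_test[OF N(1)]) (auto simp: M_def)
  define e where "e = (\<lambda>(k, \<alpha>). c k \<alpha>)"
  have sum: "(\<lambda>j. \<bar>e j\<bar> * \<rho> ^ total_degree (snd j)) summable_on S \<times> multi_indices"
    using \<open>0 < \<rho>\<close> by (intro summable_on_SigmaI[OF _ Msum]) (simp_all add: e_def cM)
  show ?thesis
  proof (rule series_norm_le_regroup[OF \<open>0 < \<rho>\<close> _ sum])
    have "(M has_sum (\<Sum>\<^sub>\<infinity>j\<in>S \<times> multi_indices. \<bar>e j\<bar> * \<rho> ^ total_degree (snd j))) S"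
      by (rule has_sum_SigmaD[OF has_sum_infsum[OF sum]]) (simp add: e_def cM)
    hence "(\<Sum>\<^sub>\<infinity>j\<in>S \<times> multi_indices. \<bar>e j\<bar> * \<rho> ^ total_degree (snd j)) \<le> infsum N S"
      by (rule has_sum_mono[OF _ has_sum_infsum[OF N(1)]]) (use cN in \<open>simp add: M_def\<close>)
    thus "(\<Sum>\<^sub>\<infinity>j\<in>S \<times> multi_indices. \<bar>e j\<bar> * \<rho> ^ total_degree (snd j)) \<le> K" using N(2) by simp
  next
    fix x assume x: "x \<in> cube a \<rho>"
    show "((\<lambda>j. e j * monomial (snd j) (x - a)) has_sum f x) (S \<times> multi_indices)"
    proof (rule has_sum_SigmaI[OF _ f[OF x]])
      show "((\<lambda>\<alpha>. e (k, \<alpha>) * monomial (snd (k, \<alpha>)) (x - a)) has_sum g k x) multi_indices"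
        if "k \<in> S" for k
        using c[OF that] x by (simp add: expands_def e_def)
      have "(\<lambda>j. norm (e j * monomial (snd j) (x - a))) summable_on S \<times> multi_indices"
        by (rule Infinite_Sum.abs_summable_on_comparison_test'[OF sum])
           (auto simp: abs_mult intro!: mult_left_mono abs_monomial_le x)
      thus "(\<lambda>j. e j * monomial (snd j) (x - a)) summable_on S \<times> multi_indices"
        by (rule abs_summable_summable)
    qed
  qed (simp only: mem_Times_iff)
qed

section \<open>Algebra operations on functions with absolutely convergent series\<close>

lemma zero_multi_index: "restrict (\<lambda>_. 0) Basis \<in> multi_indices"
  by simp

lemma series_norm_le_const: 
  assumes "0 < \<rho>"
  shows "series_norm_le a \<rho> (\<lambda>_. k) \<bar>k\<bar>"
proof (rule series_norm_le_regroup[where J = "{()}" and e = "\<lambda>_. k" and \<pi> = "\<lambda>_. restrict (\<lambda>_. 0) Basis"])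
  show "((\<lambda>j. k * monomial (restrict (\<lambda>_. 0) Basis) (x - a)) has_sum k) {()}" for x
    by (rule has_sum_finiteI) (auto simp: monomial_def)
qed (use assms in \<open>auto simp: total_degree_def\<close>)

lemma series_norm_le_add:
  assumes "0 < \<rho>" "series_norm_le a \<rho> f K" "series_norm_le a \<rho> g L"
  shows "series_norm_le a \<rho> (\<lambda>x. f x + g x) (K + L)"
proof (rule series_norm_le_has_sum[where S = UNIV and g = "\<lambda>k. if k then f else g" and N = "\<lambda>k. if k then K else L"])
  show "((\<lambda>k. (if k then f else g) x) has_sum f x + g x) UNIV" for x
    by (rule has_sum_finiteI) (auto simp: UNIV_bool)
qed (use assms in \<open>auto simp: UNIV_bool\<close>)

text \<open>Multi-indices are extensional functions, hence the restriction to \<open>Basis\<close>: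
  a plain pointwise sum would in general leave \<open>multi_indices\<close>.\<close>

definition add_index :: "('a::euclidean_space \<Rightarrow> nat) \<Rightarrow> ('a \<Rightarrow> nat) \<Rightarrow> 'a \<Rightarrow> nat" where
  "add_index \<alpha> \<beta> = restrict (\<lambda>b. \<alpha> b + \<beta> b) Basis"

lemma add_index_mem: "add_index \<alpha> \<beta> \<in> multi_indices"
  by (simp add: add_index_def)

lemma total_degree_add_index: "total_degree (add_index \<alpha> \<beta>) = total_degree \<alpha> + total_degree \<beta>"
  by (simp add: total_degree_def add_index_def sum.distrib)

lemma monomial_add_index: "monomial (add_index \<alpha> \<beta>) y = monomial \<alpha> y * monomial \<beta> y"
  by (simp add: monomial_def add_index_def power_add prod.distrib)

text \<open>Multiplying by one monomial only shifts the multi-indices. A product of two series is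
  then the sum of such shifted copies of the second factor, one for each term of the first.\<close>

lemma series_norm_le_monomial_mult:
  assumes "0 < \<rho>" "series_norm_le a \<rho> f K"
  shows "series_norm_le a \<rho> (\<lambda>x. k * monomial \<alpha> (x - a) * f x) (\<bar>k\<bar> * \<rho> ^ total_degree \<alpha> * K)"
proof -
  obtain c where c: "expands a \<rho> c f" and K: "(\<Sum>\<^sub>\<infinity>\<alpha>\<in>multi_indices. \<bar>c \<alpha>\<bar> * \<rho> ^ total_degree \<alpha>) \<le> K"
    using assms(2) by (auto simp: series_norm_le_def)
  have sum: "(\<lambda>\<beta>. \<bar>c \<beta>\<bar> * \<rho> ^ total_degree \<beta>) summable_on multi_indices"
    using c by (simp add: expands_def)
  have eq: "\<bar>k * c \<beta>\<bar> * \<rho> ^ total_degree (add_index \<alpha> \<beta>) =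
      (\<bar>k\<bar> * \<rho> ^ total_degree \<alpha>) * (\<bar>c \<beta>\<bar> * \<rho> ^ total_degree \<beta>)" for \<beta>
    by (simp add: total_degree_add_index power_add abs_mult)
  show ?thesis
  proof (rule series_norm_le_regroup[where J = multi_indices and e = "\<lambda>\<beta>. k * c \<beta>" and \<pi> = "add_index \<alpha>"])
    show "(\<lambda>\<beta>. \<bar>k * c \<beta>\<bar> * \<rho> ^ total_degree (add_index \<alpha> \<beta>)) summable_on multi_indices"
      unfolding eq by (rule summable_on_cmult_right[OF sum])
    have "(\<Sum>\<^sub>\<infinity>\<beta>\<in>multi_indices. \<bar>k * c \<beta>\<bar> * \<rho> ^ total_degree (add_index \<alpha> \<beta>)) =
       (\<bar>k\<bar> * \<rho> ^ total_degree \<alpha>) * (\<Sum>\<^sub>\<infinity>\<alpha>\<in>multi_indices. \<bar>c \<alpha>\<bar> * \<rho> ^ total_degree \<alpha>)"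
      unfolding eq by (rule infsum_cmult_right[OF sum])
    also have "\<dots> \<le> \<bar>k\<bar> * \<rho> ^ total_degree \<alpha> * K"
      using K assms(1) by (intro mult_left_mono) auto
    finally show "(\<Sum>\<^sub>\<infinity>\<beta>\<in>multi_indices. \<bar>k * c \<beta>\<bar> * \<rho> ^ total_degree (add_index \<alpha> \<beta>))
      \<le> \<bar>k\<bar> * \<rho> ^ total_degree \<alpha> * K" .
    fix x assume "x \<in> cube a \<rho>"
    hence "((\<lambda>\<beta>. c \<beta> * monomial \<beta> (x - a)) has_sum f x) multi_indices"
      using c by (simp add: expands_def)
    from has_sum_cmult_right[OF this, of "k * monomial \<alpha> (x - a)"]
    show "((\<lambda>\<beta>. k * c \<beta> * monomial (add_index \<alpha> \<beta>) (x - a)) has_sum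
        k * monomial \<alpha> (x - a) * f x) multi_indices"
      by (simp add: monomial_add_index mult_ac)
  qed (use assms add_index_mem in blast)+
qed

lemma series_norm_le_monomial:
  assumes "0 < \<rho>"
  shows "series_norm_le a \<rho> (\<lambda>x. k * monomial \<alpha> (x - a)) (\<bar>k\<bar> * \<rho> ^ total_degree \<alpha>)"
  using series_norm_le_monomial_mult[OF assms series_norm_le_const[OF assms, of a 1]] by simp

lemma series_norm_le_coordinate:
  assumes "0 < \<rho>" "b \<in> Basis"
  shows "series_norm_le a \<rho> (\<lambda>x. (x - a) \<bullet> b) \<rho>"
proof -
  have "monomial (\<lambda>b'. if b' = b then 1 else 0) y = y \<bullet> b" for y
    using assms(2) by (simp add: monomial_def if_distrib[of "\<lambda>n. (y \<bullet> _) ^ n"] prod.delta cong: if_cong)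
  moreover have "total_degree (\<lambda>b'. if b' = b then 1 else 0) = 1"
    using assms(2) by (simp add: total_degree_def)
  ultimately show ?thesis
    using series_norm_le_monomial[OF assms(1), of a 1 "\<lambda>b'. if b' = b then 1 else 0"] by simp
qed

lemma series_norm_le_mult:
  assumes "0 < \<rho>" "series_norm_le a \<rho> f K" "series_norm_le a \<rho> g L"
  shows "series_norm_le a \<rho> (\<lambda>x. f x * g x) (K * L)"
proof -
  obtain c where c: "expands a \<rho> c f" and K: "(\<Sum>\<^sub>\<infinity>\<alpha>\<in>multi_indices. \<bar>c \<alpha>\<bar> * \<rho> ^ total_degree \<alpha>) \<le> K"
    using assms(2) by (auto simp: series_norm_le_def)
  have sum: "(\<lambda>\<alpha>. \<bar>c \<alpha>\<bar> * \<rho> ^ total_degree \<alpha>) summable_on multi_indices"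
    using c by (simp add: expands_def)
  show ?thesis
  proof (rule series_norm_le_has_sum[OF assms(1) series_norm_le_monomial_mult[OF assms(1,3)]])
    show "(\<lambda>\<alpha>. \<bar>c \<alpha>\<bar> * \<rho> ^ total_degree \<alpha> * L) summable_on multi_indices"
      by (rule summable_on_cmult_left[OF sum])
    have "(\<Sum>\<^sub>\<infinity>\<alpha>\<in>multi_indices. \<bar>c \<alpha>\<bar> * \<rho> ^ total_degree \<alpha> * L) =
        (\<Sum>\<^sub>\<infinity>\<alpha>\<in>multi_indices. \<bar>c \<alpha>\<bar> * \<rho> ^ total_degree \<alpha>) * L"
      by (rule infsum_cmult_left[OF sum])
    also have "\<dots> \<le> K * L"
      using K series_norm_le_nonneg[OF assms(3)] assms(1) by (intro mult_right_mono) auto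
    finally show "(\<Sum>\<^sub>\<infinity>\<alpha>\<in>multi_indices. \<bar>c \<alpha>\<bar> * \<rho> ^ total_degree \<alpha> * L) \<le> K * L" .
    fix x assume "x \<in> cube a \<rho>"
    thus "((\<lambda>\<alpha>. c \<alpha> * monomial \<alpha> (x - a) * g x) has_sum f x * g x) multi_indices"
      using c by (intro has_sum_cmult_left) (simp add: expands_def)
  qed
qed

lemma series_norm_le_power:
  assumes "0 < \<rho>" "series_norm_le a \<rho> f K"
  shows "series_norm_le a \<rho> (\<lambda>x. f x ^ n) (K ^ n)"
proof (induction n)
  case 0
  show ?case using series_norm_le_const[OF assms(1), of a 1] by simp
next
  case (Suc n)
  show ?case using series_norm_le_mult[OF assms(1,2) Suc] by simp
qed

lemma series_norm_le_prod:
  assumes "0 < \<rho>" "finite S" "\<And>i. i \<in> S \<Longrightarrow> series_norm_le a \<rho> (f i) (K i)"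
  shows "series_norm_le a \<rho> (\<lambda>x. \<Prod>i\<in>S. f i x) (\<Prod>i\<in>S. K i)"
  using assms(2,3)
proof (induction S)
  case empty
  show ?case using series_norm_le_const[OF assms(1), of a 1] by simp
next
  case (insert i S)
  thus ?case using series_norm_le_mult[OF assms(1), of a "f i" "K i"] by simp
qed

lemma monomial_zero:
  assumes "\<alpha> \<in> multi_indices"
  shows "monomial \<alpha> 0 = (if \<alpha> = restrict (\<lambda>_. 0) Basis then 1 else 0)"
proof (cases "\<forall>b\<in>Basis. \<alpha> b = 0")
  case True
  have "\<alpha> = restrict (\<lambda>_. 0) Basis"
    by (rule PiE_ext[OF assms zero_multi_index]) (use True in simp)
  thus ?thesis by (simp add: monomial_def)
next
  case False
  thus ?thesis by (auto simp: monomial_def zero_power restrict_def)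
qed

lemma total_degree_pos:
  assumes "\<alpha> \<in> multi_indices" "\<alpha> \<noteq> restrict (\<lambda>_. 0) Basis"
  shows "0 < total_degree \<alpha>"
proof (rule ccontr)
  assume "\<not> 0 < total_degree \<alpha>"
  hence z: "\<forall>b\<in>Basis. \<alpha> b = 0" by (simp add: total_degree_def)
  have "\<alpha> = restrict (\<lambda>_. 0) Basis"
    by (rule PiE_ext[OF assms(1) zero_multi_index]) (use z in simp)
  thus False using assms(2) by simp
qed

text \<open>At the centre all monomials but the constant one vanish. Uniqueness of this single
  coefficient serves two purposes: a function vanishing at the centre has no constant term, and the
  two mixed derivatives can be compared there.\<close>

lemma expands_center:
  assumes "expands a \<rho> c f" "0 < \<rho>"
  shows "c (restrict (\<lambda>_. 0) Basis) = f a"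
proof -
  have "((\<lambda>\<alpha>. c \<alpha> * monomial \<alpha> (a - a)) has_sum f a) multi_indices"
    using assms(1) center_in_cube[of \<rho> a] assms(2) unfolding expands_def
    by (meson less_imp_le)
  moreover have "((\<lambda>\<alpha>. c \<alpha> * monomial \<alpha> (a - a)) has_sum c (restrict (\<lambda>_. 0) Basis)) multi_indices"
  proof (rule has_sum_finite_neutralI[where B = "{restrict (\<lambda>_. 0) Basis}"])
  qed (simp_all add: monomial_zero)
  ultimately show ?thesis by (rule has_sum_unique[rotated])
qed

text \<open>Without a constant term, every remaining term has positive degree and gains at least one
  factor \<open>t\<close> on the smaller cube. The norm can thus be made as small as the Neumann
  series requires.\<close>

lemma series_norm_le_shrink:
  assumes "0 < \<rho>" "series_norm_le a \<rho> f K" "f a = 0" "0 < t" "t \<le> 1"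
  shows "series_norm_le a (t * \<rho>) f (t * K)"
proof -
  obtain c where c: "expands a \<rho> c f" and K: "(\<Sum>\<^sub>\<infinity>\<alpha>\<in>multi_indices. \<bar>c \<alpha>\<bar> * \<rho> ^ total_degree \<alpha>) \<le> K"
    using assms(2) by (auto simp: series_norm_le_def)
  have sum: "(\<lambda>\<alpha>. \<bar>c \<alpha>\<bar> * \<rho> ^ total_degree \<alpha>) summable_on multi_indices"
    using c by (simp add: expands_def)
  have c0: "c (restrict (\<lambda>_. 0) Basis) = 0"
    using expands_center[OF c assms(1)] assms(3) by simp
  have le: "\<bar>c \<alpha>\<bar> * (t * \<rho>) ^ total_degree \<alpha> \<le> t * (\<bar>c \<alpha>\<bar> * \<rho> ^ total_degree \<alpha>)"
    if "\<alpha> \<in> multi_indices" for \<alpha>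
  proof (cases "\<alpha> = restrict (\<lambda>_. 0) Basis")
    case True
    thus ?thesis by (simp add: c0)
  next
    case False
    have "t ^ total_degree \<alpha> \<le> t ^ 1"
      using total_degree_pos[OF that False] assms by (intro power_decreasing) auto
    hence "t ^ total_degree \<alpha> * (\<bar>c \<alpha>\<bar> * \<rho> ^ total_degree \<alpha>) \<le> t * (\<bar>c \<alpha>\<bar> * \<rho> ^ total_degree \<alpha>)"
      using assms(1) by (intro mult_right_mono) auto
    thus ?thesis by (simp add: power_mult_distrib mult_ac)
  qed
  have sum': "(\<lambda>\<alpha>. \<bar>c \<alpha>\<bar> * (t * \<rho>) ^ total_degree \<alpha>) summable_on multi_indices"
    by (rule summable_on_comparison_test[OF summable_on_cmult_right[OF sum, of t] le])
       (use assms(1,4) in \<open>auto intro!: mult_nonneg_nonneg zero_le_power\<close>)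
  have "(\<Sum>\<^sub>\<infinity>\<alpha>\<in>multi_indices. \<bar>c \<alpha>\<bar> * (t * \<rho>) ^ total_degree \<alpha>)
      \<le> (\<Sum>\<^sub>\<infinity>\<alpha>\<in>multi_indices. t * (\<bar>c \<alpha>\<bar> * \<rho> ^ total_degree \<alpha>))"
    by (rule infsum_mono[OF sum' summable_on_cmult_right[OF sum] le])
  also have "\<dots> = t * (\<Sum>\<^sub>\<infinity>\<alpha>\<in>multi_indices. \<bar>c \<alpha>\<bar> * \<rho> ^ total_degree \<alpha>)"
    by (rule infsum_cmult_right[OF sum])
  also have "\<dots> \<le> t * K" using K assms(4) by simp
  finally have "(\<Sum>\<^sub>\<infinity>\<alpha>\<in>multi_indices. \<bar>c \<alpha>\<bar> * (t * \<rho>) ^ total_degree \<alpha>) \<le> t * K" .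
  moreover have "cube a (t * \<rho>) \<subseteq> cube a \<rho>"
    using assms by (intro cube_mono) simp
  ultimately show ?thesis
    using c sum' unfolding series_norm_le_def expands_def by (intro exI[of _ c]) auto
qed

lemma series_norm_le_smaller:
  assumes "series_norm_le a \<rho> f K" "0 < \<sigma>" "\<sigma> \<le> \<rho>"
  shows "series_norm_le a \<sigma> f K"
proof -
  obtain c where c: "expands a \<rho> c f" and K: "(\<Sum>\<^sub>\<infinity>\<alpha>\<in>multi_indices. \<bar>c \<alpha>\<bar> * \<rho> ^ total_degree \<alpha>) \<le> K"
    using assms(1) by (auto simp: series_norm_le_def)
  have sum: "(\<lambda>\<alpha>. \<bar>c \<alpha>\<bar> * \<rho> ^ total_degree \<alpha>) summable_on multi_indices"
    using c by (simp add: expands_def)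
  have le: "\<bar>c \<alpha>\<bar> * \<sigma> ^ total_degree \<alpha> \<le> \<bar>c \<alpha>\<bar> * \<rho> ^ total_degree \<alpha>" for \<alpha>
    using assms by (intro mult_left_mono power_mono) auto
  have sum': "(\<lambda>\<alpha>. \<bar>c \<alpha>\<bar> * \<sigma> ^ total_degree \<alpha>) summable_on multi_indices"
    by (rule summable_on_comparison_test[OF sum le]) (use assms in simp)
  have "(\<Sum>\<^sub>\<infinity>\<alpha>\<in>multi_indices. \<bar>c \<alpha>\<bar> * \<sigma> ^ total_degree \<alpha>) \<le> K"
    by (rule order_trans[OF infsum_mono[OF sum' sum le] K])
  thus ?thesis
    using c sum' cube_mono[OF assms(3), of a] unfolding series_norm_le_def expands_def
    by (intro exI[of _ c]) auto
qed

section \<open>Analyticity at a point in terms of cubes, and its closure properties\<close>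

lemma cube_subset_ball:
  fixes a :: "'a::euclidean_space"
  assumes "real DIM('a) * \<rho> < r"
  shows "cube a \<rho> \<subseteq> ball a r"
proof
  fix x assume "x \<in> cube a \<rho>"
  have "norm (x - a) \<le> (\<Sum>b\<in>Basis. \<bar>(x - a) \<bullet> b\<bar>)" by (rule norm_le_l1)
  also have "\<dots> \<le> (\<Sum>b\<in>(Basis::'a set). \<rho>)"
    using \<open>x \<in> cube a \<rho>\<close> by (intro sum_mono) (simp add: cube_def)
  finally show "x \<in> ball a r"
    using assms by (simp add: dist_norm norm_minus_commute)
qed

lemma real_analytic_at_iff:
  "real_analytic_at f a \<longleftrightarrow> (\<exists>\<rho>>0. \<exists>K. series_norm_le a \<rho> f K)"
proof
  assume "real_analytic_at f a"
  then obtain r c where "r > 0"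
    and c: "\<And>x. x \<in> ball a r \<Longrightarrow> ((\<lambda>\<alpha>. c \<alpha> * monomial \<alpha> (x - a)) has_sum f x) multi_indices"
    unfolding real_analytic_at_def monomial_def by blast
  \<comment> \<open>A cube of half-width \<rho> reaches at most \<open>DIM('a) * \<rho>\<close> from
    its centre; the added 1 makes this strictly less than \<open>r\<close>.\<close>
  define \<rho> where "\<rho> = r / (real DIM('a) + 1)"
  have "\<rho> > 0" using \<open>r > 0\<close> by (simp add: \<rho>_def)
  have "real DIM('a) * \<rho> < (real DIM('a) + 1) * \<rho>" using \<open>\<rho> > 0\<close> by simp
  also have "\<dots> = r" by (simp add: \<rho>_def field_simps)
  finally have sub: "cube a \<rho> \<subseteq> ball a r" by (rule cube_subset_ball)
  \<comment> \<open>The corner of the cube. Unconditional convergence at this single point is, for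
    real series, absolute convergence, and it is exactly the weighted summability demanded by
    \<open>expands\<close>.\<close>
  define z where "z = a + \<rho> *\<^sub>R One"
  have z: "(z - a) \<bullet> b = \<rho>" if "b \<in> Basis" for b
    using that by (simp add: z_def inner_sum_left inner_Basis)
  have "z \<in> cube a \<rho>" using \<open>\<rho> > 0\<close> by (simp add: cube_def z)
  moreover have "monomial \<alpha> (z - a) = \<rho> ^ total_degree \<alpha>" for \<alpha>
    by (simp add: monomial_def total_degree_def power_sum z)
  ultimately have "(\<lambda>\<alpha>. c \<alpha> * \<rho> ^ total_degree \<alpha>) summable_on multi_indices"
    using has_sum_imp_summable[OF c[OF subsetD[OF sub, of z]]] by simp
  hence "(\<lambda>\<alpha>. norm (c \<alpha> * \<rho> ^ total_degree \<alpha>)) summable_on multi_indices"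
    by (rule summable_on_iff_abs_summable_on_real[THEN iffD1])
  hence "(\<lambda>\<alpha>. \<bar>c \<alpha>\<bar> * \<rho> ^ total_degree \<alpha>) summable_on multi_indices"
    using \<open>\<rho> > 0\<close> by (simp add: abs_mult)
  moreover have "\<forall>x\<in>cube a \<rho>. ((\<lambda>\<alpha>. c \<alpha> * monomial \<alpha> (x - a)) has_sum f x) multi_indices"
    using c sub by blast
  ultimately have "expands a \<rho> c f"
    unfolding expands_def by (rule conjI)
  thus "\<exists>\<rho>>0. \<exists>K. series_norm_le a \<rho> f K"
    using \<open>\<rho> > 0\<close> unfolding series_norm_le_def by blast
next
  assume "\<exists>\<rho>>0. \<exists>K. series_norm_le a \<rho> f K"
  then obtain \<rho> c where "\<rho> > 0" "expands a \<rho> c f"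
    unfolding series_norm_le_def by blast
  thus "real_analytic_at f a"
    using ball_subset_cube[of a \<rho>] unfolding real_analytic_at_def expands_def monomial_def
    by blast
qed

lemma real_analytic_at_cong:
  assumes "real_analytic_at f a" "open S" "a \<in> S" "\<And>x. x \<in> S \<Longrightarrow> f x = g x"
  shows "real_analytic_at g a"
proof -
  obtain r c where "r > 0"
    and c: "\<forall>x\<in>ball a r. ((\<lambda>\<alpha>. c \<alpha> * (\<Prod>b\<in>Basis. ((x - a) \<bullet> b) ^ \<alpha> b)) has_sum f x) multi_indices"
    using assms(1) unfolding real_analytic_at_def by blast
  obtain r' where "r' > 0" "ball a r' \<subseteq> S"
    using assms(2,3) by (auto simp: open_contains_ball)
  hence "\<forall>x\<in>ball a (min r r'). ((\<lambda>\<alpha>. c \<alpha> * (\<Prod>b\<in>Basis. ((x - a) \<bullet> b) ^ \<alpha> b)) has_sum g x) multi_indices"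
    using c assms(4) by (metis (no_types, lifting) Int_iff ball_min_Int subsetD)
  moreover have "min r r' > 0" using \<open>r > 0\<close> \<open>r' > 0\<close> by simp
  ultimately show ?thesis unfolding real_analytic_at_def by blast
qed

lemma real_analytic_at_common_radius:
  assumes "real_analytic_at f a" "real_analytic_at g a"
  obtains \<rho> K L where "\<rho> > 0" "series_norm_le a \<rho> f K" "series_norm_le a \<rho> g L"
proof -
  obtain \<rho>1 K where 1: "\<rho>1 > 0" "series_norm_le a \<rho>1 f K"
    using assms(1) by (auto simp: real_analytic_at_iff)
  obtain \<rho>2 L where 2: "\<rho>2 > 0" "series_norm_le a \<rho>2 g L"
    using assms(2) by (auto simp: real_analytic_at_iff)
  show ?thesis
    by (rule that[of "min \<rho>1 \<rho>2"])
       (use 1 2 in \<open>auto intro: series_norm_le_smaller\<close>)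
qed

lemma real_analytic_at_const: "real_analytic_at (\<lambda>_. k) a"
  using series_norm_le_const zero_less_one unfolding real_analytic_at_iff by blast

lemma real_analytic_at_add:
  assumes "real_analytic_at f a" "real_analytic_at g a"
  shows "real_analytic_at (\<lambda>x. f x + g x) a"
  using real_analytic_at_common_radius[OF assms] series_norm_le_add
  unfolding real_analytic_at_iff by metis

lemma real_analytic_at_mult:
  assumes "real_analytic_at f a" "real_analytic_at g a"
  shows "real_analytic_at (\<lambda>x. f x * g x) a"
  using real_analytic_at_common_radius[OF assms] series_norm_le_mult
  unfolding real_analytic_at_iff by metis

lemma real_analytic_at_diff:
  assumes "real_analytic_at f a" "real_analytic_at g a"
  shows "real_analytic_at (\<lambda>x. f x - g x) a"
  using real_analytic_at_add[OF assms(1) real_analytic_at_mult[OF real_analytic_at_const[of "-1"] assms(2)]]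
  by simp

lemma real_analytic_at_coordinate:
  assumes "b \<in> Basis"
  shows "real_analytic_at (\<lambda>x. x \<bullet> b) a"
proof -
  have "real_analytic_at (\<lambda>x. (x - a) \<bullet> b) a"
    using series_norm_le_coordinate[OF zero_less_one assms] zero_less_one
    unfolding real_analytic_at_iff by blast
  from real_analytic_at_add[OF this real_analytic_at_const[of "a \<bullet> b"]]
  show ?thesis by (simp add: inner_diff_left)
qed

lemma real_analytic_at_inverse:
  assumes "real_analytic_at f a" "f a \<noteq> 0"
  shows "real_analytic_at (\<lambda>x. inverse (f x)) a"
proof -
  \<comment> \<open>Neumann series \<open>\<Sum>k. h x ^ k\<close> on a cube so small that \<open>h\<close> has norm at most \<open>1/2\<close>\<close>
  define h where "h x = 1 - inverse (f a) * f x" for x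
  have "real_analytic_at h a"
    unfolding h_def by (intro real_analytic_at_diff real_analytic_at_mult real_analytic_at_const assms)
  then obtain \<rho> K where "\<rho> > 0" and K: "series_norm_le a \<rho> h K"
    unfolding real_analytic_at_iff by blast
  have "K \<ge> 0" using series_norm_le_nonneg[OF K] \<open>\<rho> > 0\<close> by simp
  \<comment> \<open>Chosen so that \<open>t * K \<le> 1 / 2\<close> also when
    \<open>K = 0\<close>.\<close>
  define t where "t = 1 / (2 * K + 2)"
  have t: "0 < t" "t \<le> 1" "t * K \<le> 1 / 2" "0 \<le> t * K"
    using \<open>K \<ge> 0\<close> by (auto simp: t_def field_simps)
  have "h a = 0" using assms(2) by (simp add: h_def)
  hence h: "series_norm_le a (t * \<rho>) h (t * K)"
    using series_norm_le_shrink[OF \<open>\<rho> > 0\<close> K] t by blast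
  have t\<rho>: "t * \<rho> > 0" using t \<open>\<rho> > 0\<close> by simp
  have geom: "((\<lambda>k. z ^ k) has_sum 1 / (1 - z)) UNIV" if "\<bar>z\<bar> < 1" for z :: real
    using that by (intro norm_summable_imp_has_sum geometric_sums) (auto simp: power_abs)
  have "series_norm_le a (t * \<rho>) (\<lambda>x. 1 / (1 - h x)) (1 / (1 - t * K))"
  proof (rule series_norm_le_has_sum[OF t\<rho> series_norm_le_power[OF t\<rho> h]])
    show "(\<lambda>k. (t * K) ^ k) summable_on UNIV" "(\<Sum>\<^sub>\<infinity>k. (t * K) ^ k) \<le> 1 / (1 - t * K)"
      using geom[of "t * K"] t by (auto simp: has_sum_iff)
    fix x assume "x \<in> cube a (t * \<rho>)"
    hence "\<bar>h x\<bar> < 1" using series_norm_le_bound[OF h] t by force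
    thus "((\<lambda>k. h x ^ k) has_sum 1 / (1 - h x)) UNIV" by (rule geom)
  qed
  hence "real_analytic_at (\<lambda>x. 1 / (1 - h x)) a"
    using t\<rho> unfolding real_analytic_at_iff by blast
  from real_analytic_at_mult[OF real_analytic_at_const[of "inverse (f a)"] this]
  show ?thesis using assms(2) by (simp add: h_def field_simps)
qed

text \<open>Since every component of \<open>P\<close> is a coordinate of \<open>x\<close>, each has
  norm at most \<rho> after centring, on a cube of the same size. Substitution therefore preserves
  the weight of every term, and the original weighted sum bounds the new series. This makes
  functions of (x, y) analytic in (x, y, w, E).\<close>

lemma real_analytic_at_pullback:
  fixes P :: "'a::euclidean_space \<Rightarrow> 'b::euclidean_space"
  assumes f: "real_analytic_at f (P a)"
    and P: "\<And>b. b \<in> Basis \<Longrightarrow> \<exists>b'\<in>Basis. \<forall>x. P x \<bullet> b = x \<bullet> b'"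
  shows "real_analytic_at (\<lambda>x. f (P x)) a"
proof -
  obtain \<rho> K where "\<rho> > 0" and "series_norm_le (P a) \<rho> f K"
    using f by (auto simp: real_analytic_at_iff)
  then obtain c where c: "expands (P a) \<rho> c f" by (auto simp: series_norm_le_def)
  have coord: "series_norm_le a \<rho> (\<lambda>x. (P x - P a) \<bullet> b) \<rho>" if "b \<in> Basis" for b
    using series_norm_le_coordinate[OF \<open>\<rho> > 0\<close>, of _ a] P[OF that]
    by (auto simp: inner_diff_left)
  have cube: "P x \<in> cube (P a) \<rho>" if "x \<in> cube a \<rho>" for x
    using series_norm_le_bound[OF coord that] by (simp add: cube_def)
  have terms: "series_norm_le a \<rho> (\<lambda>x. c \<alpha> * monomial \<alpha> (P x - P a)) (\<bar>c \<alpha>\<bar> * \<rho> ^ total_degree \<alpha>)" for \<alpha>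
    unfolding monomial_def total_degree_def power_sum using \<open>\<rho> > 0\<close>
    by (intro series_norm_le_mult series_norm_le_const series_norm_le_prod series_norm_le_power coord)
       auto
  have "series_norm_le a \<rho> (\<lambda>x. f (P x)) (\<Sum>\<^sub>\<infinity>\<alpha>\<in>multi_indices. \<bar>c \<alpha>\<bar> * \<rho> ^ total_degree \<alpha>)"
    by (rule series_norm_le_has_sum[OF \<open>\<rho> > 0\<close> terms]) (use c cube in \<open>auto simp: expands_def\<close>)
  thus ?thesis using \<open>\<rho> > 0\<close> by (auto simp: real_analytic_at_iff)
qed

section \<open>Termwise differentiation and mixed partial derivatives\<close>

definition partial_coeff ::
  "'a::euclidean_space \<Rightarrow> (('a \<Rightarrow> nat) \<Rightarrow> real) \<Rightarrow> ('a \<Rightarrow> nat) \<Rightarrow> real" where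
  "partial_coeff b c \<alpha> = real (Suc (\<alpha> b)) * c (\<alpha>(b := Suc (\<alpha> b)))"

text \<open>The source of the symmetry of second derivatives: it is an identity between formal
  coefficients, valid before any convergence is considered.\<close>

lemma partial_coeff_commute: "partial_coeff b (partial_coeff b' c) = partial_coeff b' (partial_coeff b c)"
  by (cases "b = b'") (auto simp: partial_coeff_def fun_upd_twist fun_eq_iff)

lemma has_sum_diff_real:
  fixes u v :: "'i \<Rightarrow> real"
  assumes "(u has_sum U) S" "(v has_sum V) S"
  shows "((\<lambda>i. u i - v i) has_sum U - V) S"
  using has_sum_add[OF assms(1) has_sum_cmult_right[OF assms(2), of "-1"]] by simp

lemma square_mult_power_bounded:
  fixes q :: real
  assumes "0 < q" "q < 1"
  shows "\<exists>C. \<forall>n. real n ^ 2 * q ^ n \<le> C"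
proof -
  have "(\<lambda>n. real n ^ 2 * q ^ n) \<longlonglongrightarrow> 0"
    using assms by real_asymp
  hence "Bseq (\<lambda>n. real n ^ 2 * q ^ n)"
    by (intro convergent_imp_Bseq convergentI)
  then obtain C where "\<And>n. norm (real n ^ 2 * q ^ n) \<le> C"
    by (auto simp: Bseq_def)
  thus ?thesis by (metis abs_le_D1 real_norm_def)
qed

text \<open>Termwise differentiation, by a second-order remainder estimate summed over all terms; the
  factor \<open>\<alpha> b ^ 2\<close> that each term produces is absorbed by shrinking the cube.\<close>

lemma expands_partial:
  fixes a :: "'a::euclidean_space"
  assumes c: "expands a \<rho> c f" and \<sigma>: "0 < \<sigma>" "\<sigma> < \<rho>" and b: "b \<in> Basis"
  obtains g M where "expands a \<sigma> (partial_coeff b c) g"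
    and "\<And>x h. x \<in> cube a \<sigma> \<Longrightarrow> x + h *\<^sub>R b \<in> cube a \<sigma> \<Longrightarrow>
      \<bar>f (x + h *\<^sub>R b) - f x - h * g x\<bar> \<le> M * h\<^sup>2"
proof -
  define s where "s \<alpha> = \<alpha>(b := Suc (\<alpha> b))" for \<alpha> :: "'a \<Rightarrow> nat"
  define rest where "rest \<alpha> y = (\<Prod>b'\<in>Basis - {b}. (y \<bullet> b') ^ \<alpha> b')" for \<alpha> :: "'a \<Rightarrow> nat" and y :: 'a
  define deg where "deg \<alpha> = (\<Sum>b'\<in>Basis - {b}. \<alpha> b')" for \<alpha> :: "'a \<Rightarrow> nat"
  \<comment> \<open>\<open>D \<alpha>\<close> is the derivative of the term with index \<alpha>, and
    \<open>D (s \<alpha>)\<close> is the term of the formal derivative with index \<alpha>. For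
    \<open>\<alpha> b = 0\<close> the truncated exponent is harmless because the factor
    \<open>real (\<alpha> b)\<close> vanishes, so summing over the image of \<open>s\<close> loses
    nothing.\<close>
  define D where "D \<alpha> y = c \<alpha> * rest \<alpha> y * (real (\<alpha> b) * (y \<bullet> b) ^ (\<alpha> b - 1))" for \<alpha> y
  have td: "total_degree \<alpha> = \<alpha> b + deg \<alpha>" for \<alpha>
    using b by (simp add: total_degree_def deg_def sum.remove)
  have mono: "monomial \<alpha> y = (y \<bullet> b) ^ \<alpha> b * rest \<alpha> y" for \<alpha> y
    using b by (simp add: monomial_def rest_def prod.remove)
  have rest_le: "\<bar>rest \<alpha> (x - a)\<bar> \<le> \<sigma> ^ deg \<alpha>" if "x \<in> cube a \<sigma>" for \<alpha> x
  proof -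
    have "\<bar>rest \<alpha> (x - a)\<bar> = (\<Prod>b'\<in>Basis - {b}. \<bar>(x - a) \<bullet> b'\<bar> ^ \<alpha> b')"
      by (simp add: rest_def abs_prod power_abs)
    also have "\<dots> \<le> (\<Prod>b'\<in>Basis - {b}. \<sigma> ^ \<alpha> b')"
      using that by (intro prod_mono conjI power_mono) (auto simp: cube_def)
    finally show ?thesis by (simp add: deg_def power_sum)
  qed
  have s_inj: "inj_on s multi_indices"
    by (rule inj_onI) (metis fun_upd_same fun_upd_triv fun_upd_upd nat.inject s_def)
  have s_mem: "s \<alpha> \<in> multi_indices" if "\<alpha> \<in> multi_indices" for \<alpha>
    using that b by (auto simp: s_def PiE_iff extensional_def)
  have s_image: "s ` multi_indices = {\<alpha>\<in>multi_indices. \<alpha> b \<noteq> 0}"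
  proof (intro equalityI subsetI)
    fix \<alpha> assume "\<alpha> \<in> s ` multi_indices"
    then obtain \<beta> where "\<beta> \<in> multi_indices" "\<alpha> = s \<beta>" by (rule imageE)
    thus "\<alpha> \<in> {\<alpha>\<in>multi_indices. \<alpha> b \<noteq> 0}"
      using s_mem[of \<beta>] by (simp only: mem_Collect_eq) (simp add: s_def)
  next
    fix \<alpha> :: "'a \<Rightarrow> nat" assume \<alpha>: "\<alpha> \<in> {\<alpha>\<in>multi_indices. \<alpha> b \<noteq> 0}"
    hence "s (\<alpha>(b := \<alpha> b - 1)) = \<alpha>" by (simp add: s_def)
    moreover have "\<alpha>(b := \<alpha> b - 1) \<in> multi_indices"
      using \<alpha> b by (auto simp: PiE_iff extensional_def)
    ultimately show "\<alpha> \<in> s ` multi_indices" by (metis imageI)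
  qed
  have td_s: "total_degree (s \<alpha>) = Suc (total_degree \<alpha>)" for \<alpha>
  proof -
    have "deg (s \<alpha>) = deg \<alpha>" unfolding deg_def by (intro sum.cong) (auto simp: s_def)
    thus ?thesis by (simp add: td s_def)
  qed
  have D_s: "D (s \<alpha>) y = partial_coeff b c \<alpha> * monomial \<alpha> y" for \<alpha> y
  proof -
    have "rest (s \<alpha>) y = rest \<alpha> y" unfolding rest_def by (intro prod.cong) (auto simp: s_def)
    thus ?thesis by (simp add: D_def mono s_def partial_coeff_def mult_ac)
  qed
  define q where "q = \<sigma> / \<rho>"
  have q: "0 < q" "q < 1" using \<sigma> by (auto simp: q_def)
  then obtain C where C: "\<And>n. real n ^ 2 * q ^ n \<le> C"
    using square_mult_power_bounded by blast
  have q\<rho>: "\<sigma> = q * \<rho>" using \<sigma> by (simp add: q_def)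
  have sum: "(\<lambda>\<alpha>. \<bar>c \<alpha>\<bar> * \<rho> ^ total_degree \<alpha>) summable_on multi_indices"
    using c by (simp add: expands_def)
  \<comment> \<open>One majorant for two series: the remainder costs the square of
    \<open>\<alpha> b\<close>, while the formal derivative costs only its first power, which the
    square dominates on the image of \<open>s\<close>.\<close>
  define W where "W \<alpha> = real (\<alpha> b) ^ 2 * \<bar>c \<alpha>\<bar> * \<sigma> ^ total_degree \<alpha>" for \<alpha>
  have W: "W summable_on multi_indices"
  proof (rule summable_on_comparison_test[OF summable_on_cmult_right[OF sum, of C]])
    fix \<alpha> :: "'a \<Rightarrow> nat"
    have "real (\<alpha> b) ^ 2 * q ^ total_degree \<alpha> \<le> real (total_degree \<alpha>) ^ 2 * q ^ total_degree \<alpha>"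
      using q by (intro mult_right_mono power_mono) (auto simp: td)
    also have "\<dots> \<le> C" by (rule C)
    finally have "real (\<alpha> b) ^ 2 * q ^ total_degree \<alpha> * (\<bar>c \<alpha>\<bar> * \<rho> ^ total_degree \<alpha>)
        \<le> C * (\<bar>c \<alpha>\<bar> * \<rho> ^ total_degree \<alpha>)"
      using \<sigma> by (intro mult_right_mono) auto
    thus "W \<alpha> \<le> C * (\<bar>c \<alpha>\<bar> * \<rho> ^ total_degree \<alpha>)"
      by (simp add: W_def q\<rho> power_mult_distrib mult_ac)
    show "0 \<le> W \<alpha>" using \<sigma> by (simp add: W_def)
  qed
  have sum': "(\<lambda>\<alpha>. \<bar>partial_coeff b c \<alpha>\<bar> * \<sigma> ^ total_degree \<alpha>) summable_on multi_indices"
  proof -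
    have "(\<lambda>\<alpha>. (1 / \<sigma>) * W \<alpha>) summable_on s ` multi_indices"
      by (rule summable_on_subset[OF summable_on_cmult_right[OF W]]) (use s_image in blast)
    hence "(\<lambda>\<alpha>. (1 / \<sigma>) * W (s \<alpha>)) summable_on multi_indices"
      unfolding summable_on_reindex[OF s_inj] by (simp add: o_def)
    thus ?thesis
    proof (rule summable_on_comparison_test)
      fix \<alpha> :: "'a \<Rightarrow> nat"
      have "real (Suc (\<alpha> b)) ^ 1 \<le> real (Suc (\<alpha> b)) ^ 2" by (rule power_increasing) auto
      hence "real (Suc (\<alpha> b)) * (\<bar>c (s \<alpha>)\<bar> * \<sigma> ^ total_degree \<alpha>)
          \<le> real (Suc (\<alpha> b)) ^ 2 * (\<bar>c (s \<alpha>)\<bar> * \<sigma> ^ total_degree \<alpha>)"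
        using \<sigma> by (intro mult_right_mono) auto
      moreover have "W (s \<alpha>) = \<sigma> * (real (Suc (\<alpha> b)) ^ 2 * (\<bar>c (s \<alpha>)\<bar> * \<sigma> ^ total_degree \<alpha>))"
        by (simp only: W_def td_s) (simp add: s_def mult_ac)
      ultimately show "\<bar>partial_coeff b c \<alpha>\<bar> * \<sigma> ^ total_degree \<alpha> \<le> 1 / \<sigma> * W (s \<alpha>)"
        using \<sigma> by (simp add: partial_coeff_def abs_mult s_def mult_ac)
      show "0 \<le> \<bar>partial_coeff b c \<alpha>\<bar> * \<sigma> ^ total_degree \<alpha>" using \<sigma> by simp
    qed
  qed
  define g where "g x = (\<Sum>\<^sub>\<infinity>\<alpha>\<in>multi_indices. partial_coeff b c \<alpha> * monomial \<alpha> (x - a))" for x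
  have g: "((\<lambda>\<alpha>. partial_coeff b c \<alpha> * monomial \<alpha> (x - a)) has_sum g x) multi_indices"
    if "x \<in> cube a \<sigma>" for x
  proof -
    have "(\<lambda>\<alpha>. norm (partial_coeff b c \<alpha> * monomial \<alpha> (x - a))) summable_on multi_indices"
      by (rule Infinite_Sum.abs_summable_on_comparison_test'[OF sum'])
         (auto simp: abs_mult intro!: mult_left_mono abs_monomial_le that)
    thus ?thesis unfolding g_def by (rule has_sum_infsum[OF abs_summable_summable])
  qed
  have gD: "((\<lambda>\<alpha>. D \<alpha> (x - a)) has_sum g x) multi_indices" if "x \<in> cube a \<sigma>" for x
  proof -
    have "((\<lambda>\<alpha>. D \<alpha> (x - a)) has_sum g x) (s ` multi_indices)"
      unfolding has_sum_reindex[OF s_inj] using g[OF that] by (simp add: o_def D_s)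
    thus ?thesis
      by (rule has_sum_cong_neutral[THEN iffD1, rotated 3]) (auto simp: s_image D_def)
  qed
  show ?thesis
  proof
    show "expands a \<sigma> (partial_coeff b c) g"
      unfolding expands_def using sum' g by simp
  next
    fix x h assume x: "x \<in> cube a \<sigma>" and xh: "x + h *\<^sub>R b \<in> cube a \<sigma>"
    define y where "y = x - a"
    define t where "t = y \<bullet> b"
    have t: "\<bar>t\<bar> \<le> \<sigma>" "\<bar>t + h\<bar> \<le> \<sigma>"
      using x xh b by (auto simp: cube_def t_def y_def inner_simps algebra_simps)
    have sub: "cube a \<sigma> \<subseteq> cube a \<rho>" using \<sigma> by (intro cube_mono) simp
    define T where "T \<alpha> = c \<alpha> * monomial \<alpha> (x + h *\<^sub>R b - a) - c \<alpha> * monomial \<alpha> (x - a) - h * D \<alpha> (x - a)" for \<alpha>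
    have T: "(T has_sum (f (x + h *\<^sub>R b) - f x - h * g x)) multi_indices"
      unfolding T_def using c subsetD[OF sub x] subsetD[OF sub xh] gD[OF x]
      by (intro has_sum_diff_real has_sum_cmult_right) (simp_all add: expands_def)
    have T_le: "norm (T \<alpha>) \<le> h\<^sup>2 / \<sigma>\<^sup>2 * W \<alpha>" for \<alpha>
    proof -
      define n where "n = \<alpha> b"
      have "rest \<alpha> (x + h *\<^sub>R b - a) = rest \<alpha> y"
        unfolding rest_def y_def
        by (intro prod.cong) (use b in \<open>auto simp: inner_simps inner_Basis\<close>)
      moreover have "(x + h *\<^sub>R b - a) \<bullet> b = t + h"
        using b by (simp add: t_def y_def inner_simps)
      ultimately have T_eq: "T \<alpha> = c \<alpha> * rest \<alpha> y * ((t + h) ^ n - t ^ n - h * (real n * t ^ (n - 1)))"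
        unfolding T_def D_def mono y_def[symmetric] by (simp add: t_def n_def algebra_simps)
      have "\<bar>(t + h) ^ n - t ^ n - h * (real n * t ^ (n - 1))\<bar> \<le> h\<^sup>2 / \<sigma>\<^sup>2 * (real n ^ 2 * \<sigma> ^ n)"
      \<comment> \<open>In the first case the remainder is exactly 0. Otherwise
        \<open>lemma_termdiff3\<close> applies, as it needs \<open>h \<noteq> 0\<close>, and
        \<open>n \<ge> 2\<close> allows \<sigma> to the power n - 2 to be rewritten as a quotient of
        \<sigma> to the power n.\<close>
      proof (cases "h = 0 \<or> n < 2")
        case True
        thus ?thesis by (cases "n = 0"; cases "n = 1") (use \<sigma> in auto)
      next
        case False
        hence "h \<noteq> 0" "n \<ge> 2" by auto
        have "(t + h) ^ n - t ^ n - h * (real n * t ^ (n - 1)) =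
            h * (((t + h) ^ n - t ^ n) / h - real n * t ^ (n - Suc 0))"
          using \<open>h \<noteq> 0\<close> by (simp add: right_diff_distrib[of h "_ / _"])
        hence "\<bar>(t + h) ^ n - t ^ n - h * (real n * t ^ (n - 1))\<bar> =
            \<bar>h\<bar> * \<bar>((t + h) ^ n - t ^ n) / h - real n * t ^ (n - Suc 0)\<bar>"
          by (simp only: abs_mult)
        also have "\<dots> \<le> \<bar>h\<bar> * (real n * real (n - Suc 0) * \<sigma> ^ (n - 2) * \<bar>h\<bar>)"
          using lemma_termdiff3[of h t \<sigma> n] t \<open>h \<noteq> 0\<close> by (intro mult_left_mono) auto
        also have "\<dots> \<le> \<bar>h\<bar> * (real n * real n * \<sigma> ^ (n - 2) * \<bar>h\<bar>)"
          using \<sigma> by (intro mult_left_mono mult_right_mono) auto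
        also have "\<dots> = h\<^sup>2 / \<sigma>\<^sup>2 * (real n ^ 2 * \<sigma> ^ n)"
          using \<sigma> \<open>n \<ge> 2\<close> by (simp add: power_diff power2_eq_square)
        finally show ?thesis .
      qed
      hence "\<bar>c \<alpha>\<bar> * \<bar>rest \<alpha> y\<bar> * \<bar>(t + h) ^ n - t ^ n - h * (real n * t ^ (n - 1))\<bar>
          \<le> \<bar>c \<alpha>\<bar> * \<sigma> ^ deg \<alpha> * (h\<^sup>2 / \<sigma>\<^sup>2 * (real n ^ 2 * \<sigma> ^ n))"
        using rest_le[OF x] \<sigma> by (intro mult_mono) (auto simp: y_def)
      thus ?thesis by (simp add: T_eq abs_mult W_def td power_add mult_ac n_def)
    qed
    have WC: "(\<lambda>\<alpha>. h\<^sup>2 / \<sigma>\<^sup>2 * W \<alpha>) summable_on multi_indices"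
      by (rule summable_on_cmult_right[OF W])
    have Tabs: "(\<lambda>\<alpha>. norm (T \<alpha>)) summable_on multi_indices"
      by (rule Infinite_Sum.abs_summable_on_comparison_test'[OF WC T_le])
    have "\<bar>f (x + h *\<^sub>R b) - f x - h * g x\<bar> = norm (infsum T multi_indices)"
      using infsumI[OF T] by simp
    also have "\<dots> \<le> (\<Sum>\<^sub>\<infinity>\<alpha>\<in>multi_indices. norm (T \<alpha>))"
      by (rule norm_infsum_bound[OF Tabs])
    also have "\<dots> \<le> (\<Sum>\<^sub>\<infinity>\<alpha>\<in>multi_indices. h\<^sup>2 / \<sigma>\<^sup>2 * W \<alpha>)"
      by (rule infsum_mono[OF Tabs WC T_le])
    also have "\<dots> = infsum W multi_indices / \<sigma>\<^sup>2 * h\<^sup>2"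
      by (subst infsum_cmult_right[OF W]) simp
    finally show "\<bar>f (x + h *\<^sub>R b) - f x - h * g x\<bar> \<le> infsum W multi_indices / \<sigma>\<^sup>2 * h\<^sup>2" .
  qed
qed

lemma has_real_derivative_of_quadratic_remainder:
  fixes f :: "real \<Rightarrow> real"
  assumes "0 < \<delta>" "\<And>h. \<bar>h\<bar> < \<delta> \<Longrightarrow> \<bar>f h - f 0 - h * d\<bar> \<le> M * h\<^sup>2"
  shows "(f has_real_derivative d) (at 0)"
proof -
  have "((\<lambda>h. (f (0 + h) - f 0) / h - d) \<longlongrightarrow> 0) (at 0)"
  proof (rule Lim_null_comparison)
    show "\<forall>\<^sub>F h in at 0. norm ((f (0 + h) - f 0) / h - d) \<le> M * \<bar>h\<bar>"
      unfolding eventually_at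
    proof (intro exI[of _ \<delta>] conjI ballI impI)
      fix h :: real assume h: "h \<noteq> 0 \<and> dist h 0 < \<delta>"
      hence "f h - f 0 - h * d = h * ((f (0 + h) - f 0) / h - d)"
        by (simp add: field_simps)
      hence "\<bar>h\<bar> * norm ((f (0 + h) - f 0) / h - d) = \<bar>f h - f 0 - h * d\<bar>"
        by (simp add: abs_mult)
      also have "\<dots> \<le> M * h\<^sup>2" using assms(2)[of h] h by (simp add: dist_norm)
      also have "\<dots> = \<bar>h\<bar> * (M * \<bar>h\<bar>)" by (simp add: power2_eq_square)
      finally show "norm ((f (0 + h) - f 0) / h - d) \<le> M * \<bar>h\<bar>" using h by simp
    qed (rule assms(1))
    show "((\<lambda>h. M * \<bar>h\<bar>) \<longlongrightarrow> 0) (at 0)"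
      by (auto intro!: tendsto_eq_intros)
  qed
  thus ?thesis by (simp add: DERIV_def LIM_zero_iff)
qed

definition has_partial :: "('a::euclidean_space \<Rightarrow> real) \<Rightarrow> 'a \<Rightarrow> real \<Rightarrow> 'a \<Rightarrow> bool" where
  "has_partial f b d x \<longleftrightarrow> ((\<lambda>t. f (x + t *\<^sub>R b)) has_real_derivative d) (at 0)"

text \<open>The remainder estimate requires both endpoints in the cube. For a point of the open ball
  this holds for all small increments, which gives a derivative at every such point and not only at
  the centre.\<close>

lemma expands_has_partial:
  fixes a :: "'a::euclidean_space"
  assumes c: "expands a \<rho> c f" and \<sigma>: "0 < \<sigma>" "\<sigma> < \<rho>" and b: "b \<in> Basis"
  obtains g where "expands a \<sigma> (partial_coeff b c) g"
    and "\<And>x. x \<in> ball a \<sigma> \<Longrightarrow> has_partial f b (g x) x"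
proof -
  obtain g M where g: "expands a \<sigma> (partial_coeff b c) g"
    and M: "\<And>x h. x \<in> cube a \<sigma> \<Longrightarrow> x + h *\<^sub>R b \<in> cube a \<sigma> \<Longrightarrow>
      \<bar>f (x + h *\<^sub>R b) - f x - h * g x\<bar> \<le> M * h\<^sup>2"
    using expands_partial[OF assms] by blast
  show ?thesis
  proof
    fix x assume x: "x \<in> ball a \<sigma>"
    then obtain \<delta> where "\<delta> > 0" and \<delta>: "ball x \<delta> \<subseteq> ball a \<sigma>"
      using open_ball open_contains_ball by metis
    show "has_partial f b (g x) x"
      unfolding has_partial_def
    proof (rule has_real_derivative_of_quadratic_remainder[OF \<open>\<delta> > 0\<close>])
      fix h :: real assume "\<bar>h\<bar> < \<delta>"
      hence "x + h *\<^sub>R b \<in> ball x \<delta>" using b by (simp add: dist_norm)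
      thus "\<bar>f (x + h *\<^sub>R b) - f (x + 0 *\<^sub>R b) - h * g x\<bar> \<le> M * h\<^sup>2"
        using M[of x h] x \<delta> ball_subset_cube[of a \<sigma>] by (auto simp del: mem_ball)
    qed
  qed (rule g)
qed

lemma real_analytic_at_has_partial:
  assumes "real_analytic_at f a" "b \<in> Basis"
  obtains g r where "r > 0" "real_analytic_at g a" "\<And>x. x \<in> ball a r \<Longrightarrow> has_partial f b (g x) x"
proof -
  obtain \<rho> c where "\<rho> > 0" and c: "expands a \<rho> c f"
    using assms(1) unfolding real_analytic_at_iff series_norm_le_def by blast
  obtain g where "expands a (\<rho>/2) (partial_coeff b c) g"
    and "\<And>x. x \<in> ball a (\<rho>/2) \<Longrightarrow> has_partial f b (g x) x"
    using expands_has_partial[OF c _ _ assms(2), of "\<rho>/2"] \<open>\<rho> > 0\<close> by auto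
  thus ?thesis
    using that[of "\<rho>/2" g] \<open>\<rho> > 0\<close> unfolding real_analytic_at_iff series_norm_le_def
    by (meson half_gt_zero order_refl)
qed

text \<open>Each differentiation costs part of the radius, hence \<rho>/2 and \<rho>/4. Both second
  derivatives at the centre are constant coefficients of twice differentiated series, and these
  coefficient families coincide.\<close>

lemma real_analytic_at_mixed_partials:
  assumes "real_analytic_at f a" "b \<in> Basis" "b' \<in> Basis"
  obtains g g' k r where "r > 0"
    "\<And>x. x \<in> ball a r \<Longrightarrow> has_partial f b (g x) x"
    "\<And>x. x \<in> ball a r \<Longrightarrow> has_partial f b' (g' x) x"
    "has_partial g b' k a" "has_partial g' b k a"
proof -
  obtain \<rho> c where "\<rho> > 0" and c: "expands a \<rho> c f"
    using assms(1) unfolding real_analytic_at_iff series_norm_le_def by blast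
  have \<rho>: "0 < \<rho>/2" "\<rho>/2 < \<rho>" "0 < \<rho>/4" "\<rho>/4 < \<rho>/2" using \<open>\<rho> > 0\<close> by auto
  obtain g where g: "expands a (\<rho>/2) (partial_coeff b c) g"
    "\<And>x. x \<in> ball a (\<rho>/2) \<Longrightarrow> has_partial f b (g x) x"
    using expands_has_partial[OF c \<rho>(1,2) assms(2)] by blast
  obtain g' where g': "expands a (\<rho>/2) (partial_coeff b' c) g'"
    "\<And>x. x \<in> ball a (\<rho>/2) \<Longrightarrow> has_partial f b' (g' x) x"
    using expands_has_partial[OF c \<rho>(1,2) assms(3)] by blast
  obtain k where k: "expands a (\<rho>/4) (partial_coeff b' (partial_coeff b c)) k"
    "\<And>x. x \<in> ball a (\<rho>/4) \<Longrightarrow> has_partial g b' (k x) x"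
    using expands_has_partial[OF g(1) \<rho>(3,4) assms(3)] by blast
  obtain k' where k': "expands a (\<rho>/4) (partial_coeff b (partial_coeff b' c)) k'"
    "\<And>x. x \<in> ball a (\<rho>/4) \<Longrightarrow> has_partial g' b (k' x) x"
    using expands_has_partial[OF g'(1) \<rho>(3,4) assms(2)] by blast
  have "k a = k' a"
    using expands_center[OF k(1) \<rho>(3)] expands_center[OF k'(1) \<rho>(3)]
    by (simp add: partial_coeff_commute[of b b'])
  moreover have "a \<in> ball a (\<rho>/4)" using \<rho> by simp
  ultimately show ?thesis using that[OF \<rho>(1) g(2) g'(2)] k(2) k'(2) by metis
qed

section \<open>Partial derivatives and derivations on jets\<close>

lemma has_partial_fst:
  assumes "has_partial f (1, 0) d (x, y)"
  shows "((\<lambda>t. f (t, y)) has_real_derivative d) (at x)"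
  using assms DERIV_shift[of "\<lambda>t. f (t, y)" d 0 x] by (simp add: has_partial_def add.commute)

lemma has_partial_snd:
  assumes "has_partial f (0, 1) d (x, y)"
  shows "((\<lambda>t. f (x, t)) has_real_derivative d) (at y)"
  using assms DERIV_shift[of "\<lambda>t. f (x, t)" d 0 y] by (simp add: has_partial_def add.commute)

lemma has_partial_pdx: "has_partial f (1, 0) d p \<Longrightarrow> pdx f p = d"
  by (cases p) (auto simp: pdx_def dest: has_partial_fst intro: DERIV_imp_deriv)

lemma has_partial_pdy: "has_partial f (0, 1) d p \<Longrightarrow> pdy f p = d"
  by (cases p) (auto simp: pdy_def dest: has_partial_snd intro: DERIV_imp_deriv)

lemma Basis_plane: "(1, 0) \<in> (Basis :: (real \<times> real) set)" "(0, 1) \<in> (Basis :: (real \<times> real) set)"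
  by (auto simp: Basis_prod_def)

lemma real_analytic_at_pdx:
  assumes "real_analytic_at f p"
  shows "real_analytic_at (pdx f) p"
proof -
  obtain g r where r: "r > 0" and g: "real_analytic_at g p"
    and part: "\<And>q. q \<in> ball p r \<Longrightarrow> has_partial f (1, 0) (g q) q"
    using real_analytic_at_has_partial[OF assms Basis_plane(1)] by blast
  show ?thesis
  proof (rule real_analytic_at_cong[OF g open_ball])
    show "p \<in> ball p r" using r by simp
    show "g q = pdx f q" if "q \<in> ball p r" for q
      using has_partial_pdx[OF part[OF that]] by simp
  qed
qed

lemma real_analytic_at_pdy:
  assumes "real_analytic_at f p"
  shows "real_analytic_at (pdy f) p"
proof -
  obtain g r where r: "r > 0" and g: "real_analytic_at g p"
    and part: "\<And>q. q \<in> ball p r \<Longrightarrow> has_partial f (0, 1) (g q) q"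
    using real_analytic_at_has_partial[OF assms Basis_plane(2)] by blast
  show ?thesis
  proof (rule real_analytic_at_cong[OF g open_ball])
    show "p \<in> ball p r" using r by simp
    show "g q = pdy f q" if "q \<in> ball p r" for q
      using has_partial_pdy[OF part[OF that]] by simp
  qed
qed

lemma has_real_derivative_pdx:
  assumes "real_analytic_at f (x, y)"
  shows "((\<lambda>t. f (t, y)) has_real_derivative pdx f (x, y)) (at x)"
proof -
  obtain g r where "r > 0" "\<And>q. q \<in> ball (x, y) r \<Longrightarrow> has_partial f (1, 0) (g q) q"
    using real_analytic_at_has_partial[OF assms Basis_plane(1)] by blast
  hence "has_partial f (1, 0) (g (x, y)) (x, y)" by simp
  from has_partial_fst[OF this] has_partial_pdx[OF this] show ?thesis by simp
qed

lemma has_real_derivative_pdy: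
  assumes "real_analytic_at f (x, y)"
  shows "((\<lambda>t. f (x, t)) has_real_derivative pdy f (x, y)) (at y)"
proof -
  obtain g r where "r > 0" "\<And>q. q \<in> ball (x, y) r \<Longrightarrow> has_partial f (0, 1) (g q) q"
    using real_analytic_at_has_partial[OF assms Basis_plane(2)] by blast
  hence "has_partial f (0, 1) (g (x, y)) (x, y)" by simp
  from has_partial_snd[OF this] has_partial_pdy[OF this] show ?thesis by simp
qed

lemma has_partial_cong:
  assumes "has_partial f b d x" "r > 0" "\<And>z. z \<in> ball x r \<Longrightarrow> f z = g z"
  shows "has_partial g b d x"
proof -
  have "((\<lambda>t. x + t *\<^sub>R b) \<longlongrightarrow> x + 0 *\<^sub>R b) (nhds 0)"
    by (intro tendsto_intros filterlim_ident)
  hence "\<forall>\<^sub>F t in nhds 0. x + t *\<^sub>R b \<in> ball x r"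
    using assms(2) by (intro topological_tendstoD) auto
  hence "\<forall>\<^sub>F t in nhds 0. f (x + t *\<^sub>R b) = g (x + t *\<^sub>R b)"
    by eventually_elim (rule assms(3))
  thus ?thesis using assms(1) unfolding has_partial_def
    by (subst DERIV_cong_ev[OF refl _ refl, symmetric])
qed

text \<open>The sum of the differentiated series agrees with \<open>pdx f\<close> on a whole ball
  and not just at \<open>p\<close>, so it may be replaced by \<open>pdx f\<close> under a further
  derivative; likewise for \<open>pdy f\<close>.\<close>

lemma pdx_pdy_commute:
  assumes "real_analytic_at f p"
  shows "pdx (pdy f) p = pdy (pdx f) p"
proof (rule real_analytic_at_mixed_partials[OF assms Basis_plane])
  fix g g' :: "real \<times> real \<Rightarrow> real" and k r :: real
  assume r: "r > 0"
    and g: "\<And>q. q \<in> ball p r \<Longrightarrow> has_partial f (1, 0) (g q) q"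
    and g': "\<And>q. q \<in> ball p r \<Longrightarrow> has_partial f (0, 1) (g' q) q"
    and k: "has_partial g (0, 1) k p" "has_partial g' (1, 0) k p"
  have "has_partial (pdx f) (0, 1) k p"
    by (rule has_partial_cong[OF k(1) r]) (simp only: has_partial_pdx[OF g])
  moreover have "has_partial (pdy f) (1, 0) k p"
    by (rule has_partial_cong[OF k(2) r]) (simp only: has_partial_pdy[OF g'])
  ultimately show "pdx (pdy f) p = pdy (pdx f) p" by (simp add: has_partial_pdx has_partial_pdy)
qed

section \<open>Coordinatewise differentiation on jets\<close>

definition jet_differentiable :: "(jet \<Rightarrow> real) \<Rightarrow> jet \<Rightarrow> bool" where
  "jet_differentiable f j \<longleftrightarrow> (\<forall>c. (\<lambda>t. f (j(c := t))) differentiable (at (j c)))"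

lemma jet_differentiable_has_derivative:
  "jet_differentiable f j \<Longrightarrow> ((\<lambda>t. f (j(c := t))) has_real_derivative jpd c f j) (at (j c))"
  by (simp add: jet_differentiable_def jpd_def DERIV_deriv_iff_real_differentiable)

lemma jpdI: "((\<lambda>t. f (j(c := t))) has_real_derivative d) (at (j c)) \<Longrightarrow> jpd c f j = d"
  by (simp add: jpd_def DERIV_imp_deriv)

lemma jet_differentiableI:
  "(\<And>c. \<exists>d. ((\<lambda>t. f (j(c := t))) has_real_derivative d) (at (j c))) \<Longrightarrow> jet_differentiable f j"
  by (simp add: jet_differentiable_def real_differentiable_def)

lemma jet_differentiable_const: "jet_differentiable (\<lambda>_. k) j"
  by (simp add: jet_differentiable_def)

lemma jpd_const: "jpd c (\<lambda>_. k) j = 0"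
  by (simp add: jpd_def)

lemma has_derivative_coord:
  "((\<lambda>t. (j(c := t)) e) has_real_derivative (if c = e then 1 else 0)) (at (j c))"
  by (auto intro: derivative_eq_intros)

lemma jet_differentiable_coord: "jet_differentiable (\<lambda>j. j e) j"
  by (intro jet_differentiableI exI) (rule has_derivative_coord)

lemma jpd_coord: "jpd c (\<lambda>j. j e) j = (if c = e then 1 else 0)"
  by (rule jpdI) (rule has_derivative_coord)

lemma
  assumes "jet_differentiable f j" "jet_differentiable g j"
  shows jet_differentiable_add: "jet_differentiable (\<lambda>j. f j + g j) j"
    and jet_differentiable_mult: "jet_differentiable (\<lambda>j. f j * g j) j"
    and jpd_add: "jpd c (\<lambda>j. f j + g j) j = jpd c f j + jpd c g j"
    and jpd_diff: "jpd c (\<lambda>j. f j - g j) j = jpd c f j - jpd c g j"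
    and jpd_mult: "jpd c (\<lambda>j. f j * g j) j = jpd c f j * g j + jpd c g j * f j"
proof -
  note D = assms[THEN jet_differentiable_has_derivative]
  have A: "((\<lambda>t. f (j(c := t)) + g (j(c := t))) has_real_derivative jpd c f j + jpd c g j) (at (j c))" for c
    by (rule DERIV_add[OF D])
  have B: "((\<lambda>t. f (j(c := t)) - g (j(c := t))) has_real_derivative jpd c f j - jpd c g j) (at (j c))" for c
    by (rule DERIV_diff[OF D])
  have C: "((\<lambda>t. f (j(c := t)) * g (j(c := t))) has_real_derivative jpd c f j * g j + jpd c g j * f j) (at (j c))" for c
    using DERIV_mult[OF D, of c] by simp
  show "jet_differentiable (\<lambda>j. f j + g j) j" by (rule jet_differentiableI, rule exI, rule A)
  show "jet_differentiable (\<lambda>j. f j * g j) j" by (rule jet_differentiableI, rule exI, rule C)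
  show "jpd c (\<lambda>j. f j + g j) j = jpd c f j + jpd c g j" by (rule jpdI) (rule A)
  show "jpd c (\<lambda>j. f j - g j) j = jpd c f j - jpd c g j" by (rule jpdI) (rule B)
  show "jpd c (\<lambda>j. f j * g j) j = jpd c f j * g j + jpd c g j * f j" by (rule jpdI) (rule C)
qed

lemma Basis_point:
  "(1, 0, 0, 0) \<in> (Basis :: point set)" "(0, 1, 0, 0) \<in> (Basis :: point set)"
  "(0, 0, 1, 0) \<in> (Basis :: point set)" "(0, 0, 0, 1) \<in> (Basis :: point set)"
  by (auto simp: Basis_prod_def zero_prod_def)

lemma jet_differentiable_base:
  assumes "real_analytic_at f (base j)"
  shows "jet_differentiable (\<lambda>j. f (base j)) j"
proof (rule jet_differentiableI)
  fix c
  \<comment> \<open>A change of one of the four base coordinates moves the base point along a basis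
    vector; the shift by \<open>j c\<close> turns the derivative at 0 into one at
    \<open>j c\<close>.\<close>
  have shift: "\<exists>d. ((\<lambda>t. f (base (j(c := t)))) has_real_derivative d) (at (j c))"
    if b: "b \<in> Basis" "\<And>t. base (j(c := t + j c)) = base j + t *\<^sub>R b" for b
  proof -
    obtain g r where "r > 0" "\<And>q. q \<in> ball (base j) r \<Longrightarrow> has_partial f b (g q) q"
      using real_analytic_at_has_partial[OF assms b(1)] by blast
    hence "has_partial f b (g (base j)) (base j)" by simp
    thus ?thesis
      using DERIV_shift[of "\<lambda>t. f (base (j(c := t)))" _ 0 "j c"] b(2)
      by (auto simp: has_partial_def)
  qed
  show "\<exists>d. ((\<lambda>t. f (base (j(c := t)))) has_real_derivative d) (at (j c))"
  proof (cases "c \<in> {Coord_x, Coord_y, Jet Dep_w 0 0, Jet Dep_E 0 0}")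
    case True
    thus ?thesis
      using shift[OF Basis_point(1)] shift[OF Basis_point(2)] shift[OF Basis_point(3)]
        shift[OF Basis_point(4)] by (auto simp: base_def)
  next
    case False
    hence "base (j(c := t)) = base j" for t by (auto simp: base_def)
    thus ?thesis by (intro exI[of _ 0]) simp
  qed
qed

lemma jpd_base:
  assumes "c \<notin> {Coord_x, Coord_y, Jet Dep_w 0 0, Jet Dep_E 0 0}"
  shows "jpd c (\<lambda>j. f (base j)) j = 0"
proof -
  have "base (j(c := t)) = base j" for t using assms by (auto simp: base_def)
  thus ?thesis by (simp add: jpd_def)
qed

text \<open>Only one coordinate moves at a time, so openness of \<Omega> in the four base variables
  is enough and no topology on the space of jets enters.\<close>

lemma eventually_base_mem:
  assumes "open \<Omega>" "base j \<in> \<Omega>"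
  shows "\<forall>\<^sub>F t in nhds (j c). base (j(c := t)) \<in> \<Omega>"
proof -
  have c: "((\<lambda>t. (j(c := t)) e) \<longlongrightarrow> j e) (nhds (j c))" for e
    by (cases "c = e") (auto simp: filterlim_ident)
  have "((\<lambda>t. base (j(c := t))) \<longlongrightarrow> base j) (nhds (j c))"
    unfolding base_def by (intro tendsto_Pair c)
  thus ?thesis using assms by (rule topological_tendstoD)
qed

text \<open>Permits \<open>A\<close> and 0 to be put in place of \<xi> and \<phi> inside
  derivatives, although they agree with these functions only on \<Omega>.\<close>

lemma jpd_cong:
  assumes "open \<Omega>" "base j \<in> \<Omega>" "\<And>j. base j \<in> \<Omega> \<Longrightarrow> f j = g j"
  shows "jpd c f j = jpd c g j"
  unfolding jpd_def
  by (rule deriv_cong_ev[OF eventually_mono[OF eventually_base_mem[OF assms(1,2)]] refl])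
     (rule assms(3))

text \<open>Common form of \<^const>\<open>total_dx\<close>, \<^const>\<open>total_dy\<close> and \<^const>\<open>prolong\<close>; the field \<open>v\<close> may itself
  depend on the jet at which it is evaluated.\<close>

definition jet_field :: "nat \<Rightarrow> (jet_coord \<Rightarrow> real) \<Rightarrow> (jet \<Rightarrow> real) \<Rightarrow> jet \<Rightarrow> real" where
  "jet_field n v f j = v Coord_x * jpd Coord_x f j + v Coord_y * jpd Coord_y f j +
     (\<Sum>d\<in>{Dep_w, Dep_E}. \<Sum>(i, k)\<in>{(i, k). i + k \<le> n}. v (Jet d i k) * jpd (Jet d i k) f j)"

lemma total_dx_eq_jet_field:
  "total_dx n f j = jet_field n (\<lambda>c. case c of Coord_x \<Rightarrow> 1 | Coord_y \<Rightarrow> 0 | Jet d i k \<Rightarrow> j (Jet d (Suc i) k)) f j"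
  by (simp add: total_dx_def jet_field_def)

lemma total_dy_eq_jet_field:
  "total_dy n f j = jet_field n (\<lambda>c. case c of Coord_x \<Rightarrow> 0 | Coord_y \<Rightarrow> 1 | Jet d i k \<Rightarrow> j (Jet d i (Suc k))) f j"
  by (simp add: total_dy_def jet_field_def)

lemma prolong_eq_jet_field:
  "prolong n V f j = jet_field n (\<lambda>c. case c of Coord_x \<Rightarrow> xi V (base j) | Coord_y \<Rightarrow> eta V (base j)
     | Jet d i k \<Rightarrow> pr_coeff V d i k j) f j"
  by (simp add: prolong_def jet_field_def)

lemma jet_field_cong:
  assumes "open \<Omega>" "base j \<in> \<Omega>" "\<And>j. base j \<in> \<Omega> \<Longrightarrow> f j = g j"
  shows "jet_field n v f j = jet_field n v g j"
  unfolding jet_field_def by (simp only: jpd_cong[OF assms])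

lemma jet_field_const: "jet_field n v (\<lambda>_. k) j = 0"
  by (simp add: jet_field_def jpd_const)

lemma finite_bounded_pairs: "finite {(i, k). i + k \<le> (n :: nat)}"
  by (rule finite_subset[of _ "{..n} \<times> {..n}"]) auto

lemma
  assumes "jet_differentiable f j" "jet_differentiable g j"
  shows jet_field_add: "jet_field n v (\<lambda>j. f j + g j) j = jet_field n v f j + jet_field n v g j"
    and jet_field_diff: "jet_field n v (\<lambda>j. f j - g j) j = jet_field n v f j - jet_field n v g j"
    and jet_field_mult: "jet_field n v (\<lambda>j. f j * g j) j = jet_field n v f j * g j + f j * jet_field n v g j"
  unfolding jet_field_def jpd_add[OF assms] jpd_diff[OF assms] jpd_mult[OF assms]
  by (simp_all add: case_prod_unfold sum.distrib sum_subtractf sum_distrib_left sum_distrib_right algebra_simps)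

lemma jet_field_coord:
  assumes "i + k \<le> n"
  shows "jet_field n v (\<lambda>j. j (Jet d i k)) j = v (Jet d i k)"
proof -
  have "(\<Sum>(i', k')\<in>{(i, k). i + k \<le> n}. v (Jet d' i' k') * (if Jet d' i' k' = Jet d i k then 1 else 0))
      = (if d' = d then v (Jet d i k) else 0)" for d'
  proof -
    have "(\<Sum>(i', k')\<in>{(i, k). i + k \<le> n}. v (Jet d' i' k') * (if Jet d' i' k' = Jet d i k then 1 else 0))
      = (\<Sum>p\<in>{(i, k). i + k \<le> n}. if p = (i, k) then (if d' = d then v (Jet d i k) else 0) else 0)"
      by (intro sum.cong) (auto split: if_splits)
    thus ?thesis using assms finite_bounded_pairs by simp
  qed
  thus ?thesis by (cases d) (simp_all add: jet_field_def jpd_coord)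
qed

text \<open>The right-hand side is free of \<open>n\<close>, so one formula covers the order-0 total
  derivatives in the prolongation coefficients and the order-1 ones in the constraints.\<close>

lemma jet_field_base:
  "jet_field n v (\<lambda>j. f (base j)) j =
     v Coord_x * jpd Coord_x (\<lambda>j. f (base j)) j + v Coord_y * jpd Coord_y (\<lambda>j. f (base j)) j +
     v (Jet Dep_w 0 0) * jpd (Jet Dep_w 0 0) (\<lambda>j. f (base j)) j +
     v (Jet Dep_E 0 0) * jpd (Jet Dep_E 0 0) (\<lambda>j. f (base j)) j"
proof -
  have zero: "jpd (Jet d i k) (\<lambda>j. f (base j)) j = 0" if "(i, k) \<noteq> (0, 0)" for d i k
    by (rule jpd_base) (use that in auto)
  define h where "h d p = (case p of (i, k) \<Rightarrow> v (Jet d i k) * jpd (Jet d i k) (\<lambda>j. f (base j)) j)" for d p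
  have "h d p = 0" if "p \<noteq> (0, 0)" for d p
    using zero that by (cases p) (simp add: h_def)
  hence "sum (h d) {(i, k). i + k \<le> n} = sum (h d) {(0, 0)}" for d
    by (intro sum.mono_neutral_right finite_bounded_pairs) auto
  hence "sum (h d) {(i, k). i + k \<le> n} = v (Jet d 0 0) * jpd (Jet d 0 0) (\<lambda>j. f (base j)) j" for d
    by (simp add: h_def)
  thus ?thesis unfolding jet_field_def h_def by simp
qed

section \<open>The nonclassical generator\<close>

definition plane :: "jet \<Rightarrow> real \<times> real" where
  "plane j = (j Coord_x, j Coord_y)"

lemma real_analytic_at_plane:
  fixes B :: "real \<times> real \<Rightarrow> real" and p :: point
  assumes "real_analytic_at B (fst p, fst (snd p))"
  shows "real_analytic_at (\<lambda>p. B (fst p, fst (snd p))) p"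
proof (rule real_analytic_at_pullback[where P = "\<lambda>p::point. (fst p, fst (snd p))", OF assms])
  fix b :: "real \<times> real" assume "b \<in> Basis"
  hence "b = (1, 0) \<or> b = (0, 1)" by (auto simp: Basis_prod_def)
  thus "\<exists>b'\<in>Basis. \<forall>x::point. (fst x, fst (snd x)) \<bullet> b = x \<bullet> b'"
  proof
    assume "b = (1, 0)"
    thus ?thesis by (intro bexI[OF _ Basis_point(1)]) (simp add: inner_prod_def)
  next
    assume "b = (0, 1)"
    thus ?thesis by (intro bexI[OF _ Basis_point(2)]) (simp add: inner_prod_def)
  qed
qed

lemma
  assumes "real_analytic_at B (plane j)"
  shows jet_differentiable_plane: "jet_differentiable (\<lambda>j. B (plane j)) j"
    and jet_field_plane: "jet_field n v (\<lambda>j. B (plane j)) j =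
      v Coord_x * pdx B (plane j) + v Coord_y * pdy B (plane j)"
proof -
  have eq: "(\<lambda>j. B (plane j)) = (\<lambda>j. (\<lambda>p. B (fst p, fst (snd p))) (base j))"
    by (simp add: plane_def base_def)
  show "jet_differentiable (\<lambda>j. B (plane j)) j"
    unfolding eq by (rule jet_differentiable_base, rule real_analytic_at_plane)
      (use assms in \<open>simp add: base_def plane_def\<close>)
  show "jet_field n v (\<lambda>j. B (plane j)) j =
      v Coord_x * pdx B (plane j) + v Coord_y * pdy B (plane j)"
    using jet_field_base[of n v "\<lambda>p. B (fst p, fst (snd p))" j]
    by (simp add: jpd_def base_def plane_def pdx_def pdy_def)
qed

section \<open>Total derivatives and prolongations for \<xi> = A and \<phi> = 0\<close>

lemma jet_field_minus:
  "jet_differentiable f j \<Longrightarrow> jet_field n v (\<lambda>j. - f j) j = - jet_field n v f j"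
  using jet_field_diff[OF jet_differentiable_const, of f j n v 0] by (simp add: jet_field_const)

lemma jet_field_F:
  assumes "2 \<le> n"
  shows "jet_field n v F j =
    v (Jet Dep_w 1 0) * j (Jet Dep_E 1 0) + j (Jet Dep_w 1 0) * v (Jet Dep_E 1 0) +
    v (Jet Dep_w 0 1) * j (Jet Dep_E 0 1) + j (Jet Dep_w 0 1) * v (Jet Dep_E 0 1) +
    v (Jet Dep_E 0 0) * (j (Jet Dep_w 2 0) + j (Jet Dep_w 0 2)) +
    j (Jet Dep_E 0 0) * (v (Jet Dep_w 2 0) + v (Jet Dep_w 0 2))"
  unfolding F_def using assms
  by (simp add: jet_field_add jet_field_mult jet_field_const jet_field_coord
      jet_differentiable_add jet_differentiable_mult jet_differentiable_const jet_differentiable_coord)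

text \<open>\<psi> is left arbitrary and \<xi>, \<phi> are fixed only on \<Omega>, so the same
  prolongation formulas serve the proposed vector field and every competing generator.\<close>

locale generator_setting =
  fixes A :: "real \<times> real \<Rightarrow> real" and \<Omega> :: "point set" and \<xi> \<phi> \<psi> :: "point \<Rightarrow> real"
  assumes open_\<Omega>: "open \<Omega>"
    and A_analytic: "\<And>x y w E. (x, y, w, E) \<in> \<Omega> \<Longrightarrow> real_analytic_at A (x, y)"
    and \<xi>: "\<And>x y w E. (x, y, w, E) \<in> \<Omega> \<Longrightarrow> \<xi> (x, y, w, E) = A (x, y)"
    and \<phi>: "\<And>p. p \<in> \<Omega> \<Longrightarrow> \<phi> p = 0"
    and \<psi>: "real_analytic_on \<psi> \<Omega>"
begin

abbreviation "V \<equiv> normalized_field \<xi> \<phi> \<psi>"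
abbreviation "\<psi>_jet \<equiv> \<lambda>j. \<psi> (base j)"

lemma plane_analytic: "base j \<in> \<Omega> \<Longrightarrow> real_analytic_at A (plane j)"
  using A_analytic by (simp add: base_def plane_def)

lemma xi_V: "base j \<in> \<Omega> \<Longrightarrow> xi V (base j) = A (plane j)"
  using \<xi> by (simp add: base_def plane_def normalized_field_def)

lemma eta_V: "eta V p = 1"
  by (simp add: normalized_field_def)

lemma coeff_V: "base j \<in> \<Omega> \<Longrightarrow> coeff V Dep_w (base j) = 0" "coeff V Dep_E p = \<psi> p"
  using \<phi> by (simp_all add: normalized_field_def)

lemma jet_field_xi:
  assumes "base j \<in> \<Omega>"
  shows "jet_field n v (\<lambda>j. xi V (base j)) j = v Coord_x * pdx A (plane j) + v Coord_y * pdy A (plane j)"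
  using jet_field_cong[OF open_\<Omega> assms, of "\<lambda>j. xi V (base j)" "\<lambda>j. A (plane j)"]
    jet_field_plane[OF plane_analytic[OF assms]] xi_V by simp

lemma jet_field_eta: "jet_field n v (\<lambda>j. eta V (base j)) j = 0"
  by (simp add: eta_V jet_field_const)

lemma \<psi>_differentiable: "base j \<in> \<Omega> \<Longrightarrow> jet_differentiable \<psi>_jet j"
  using \<psi> by (intro jet_differentiable_base) (simp add: real_analytic_on_def)

lemma jet_field_\<phi>\<^sub>1:
  assumes "base j \<in> \<Omega>" "1 \<le> n"
  shows "jet_field n v (inv_surface V Dep_w) j =
    (v Coord_x * pdx A (plane j) + v Coord_y * pdy A (plane j)) * j (Jet Dep_w 1 0)
    + A (plane j) * v (Jet Dep_w 1 0) + v (Jet Dep_w 0 1)"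
proof -
  have "jet_field n v (inv_surface V Dep_w) j =
      jet_field n v (\<lambda>j. A (plane j) * j (Jet Dep_w 1 0) + j (Jet Dep_w 0 1)) j"
    by (rule jet_field_cong[OF open_\<Omega> assms(1)]) (simp add: inv_surface_def xi_V eta_V coeff_V)
  thus ?thesis
    using jet_differentiable_plane[OF plane_analytic] jet_field_plane[OF plane_analytic] assms
    by (simp add: jet_field_add jet_field_mult jet_field_coord
        jet_differentiable_mult jet_differentiable_coord)
qed

lemma jet_field_\<phi>\<^sub>2:
  assumes "base j \<in> \<Omega>" "1 \<le> n"
  shows "jet_field n v (inv_surface V Dep_E) j =
    (v Coord_x * pdx A (plane j) + v Coord_y * pdy A (plane j)) * j (Jet Dep_E 1 0)
    + A (plane j) * v (Jet Dep_E 1 0) + v (Jet Dep_E 0 1) - jet_field n v \<psi>_jet j"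
proof -
  have "jet_field n v (inv_surface V Dep_E) j =
      jet_field n v (\<lambda>j. A (plane j) * j (Jet Dep_E 1 0) + j (Jet Dep_E 0 1) - \<psi> (base j)) j"
    by (rule jet_field_cong[OF open_\<Omega> assms(1)]) (simp add: inv_surface_def xi_V eta_V coeff_V)
  thus ?thesis
    using jet_differentiable_plane[OF plane_analytic] jet_field_plane[OF plane_analytic]
      \<psi>_differentiable assms
    by (simp add: jet_field_add jet_field_diff jet_field_mult jet_field_coord
        jet_differentiable_add jet_differentiable_mult jet_differentiable_coord)
qed

lemma total_xi:
  assumes "base j \<in> \<Omega>"
  shows "total_dx n (\<lambda>j. xi V (base j)) j = pdx A (plane j)"
    and "total_dy n (\<lambda>j. xi V (base j)) j = pdy A (plane j)"
  by (simp_all add: total_dx_eq_jet_field total_dy_eq_jet_field jet_field_xi[OF assms])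

lemma total_eta:
  "total_dx n (\<lambda>j. eta V (base j)) j = 0" "total_dy n (\<lambda>j. eta V (base j)) j = 0"
  by (simp_all add: total_dx_eq_jet_field total_dy_eq_jet_field jet_field_eta)

lemma total_coeff_w:
  assumes "base j \<in> \<Omega>"
  shows "total_dx n (\<lambda>j. coeff V Dep_w (base j)) j = 0"
    and "total_dy n (\<lambda>j. coeff V Dep_w (base j)) j = 0"
  using jet_field_cong[OF open_\<Omega> assms, of "\<lambda>j. coeff V Dep_w (base j)" "\<lambda>_. 0"]
  by (simp_all add: total_dx_eq_jet_field total_dy_eq_jet_field coeff_V jet_field_const)

lemma pr_coeff_first:
  assumes "base j \<in> \<Omega>"
  shows "pr_coeff V Dep_w 1 0 j = - j (Jet Dep_w 1 0) * pdx A (plane j)"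
    and "pr_coeff V Dep_w 0 1 j = - j (Jet Dep_w 1 0) * pdy A (plane j)"
    and "pr_coeff V Dep_E 1 0 j = total_dx 0 \<psi>_jet j - j (Jet Dep_E 1 0) * pdx A (plane j)"
    and "pr_coeff V Dep_E 0 1 j = total_dy 0 \<psi>_jet j - j (Jet Dep_E 1 0) * pdy A (plane j)"
  using total_xi[OF assms] total_eta total_coeff_w[OF assms]
  by (simp_all add: coeff_V One_nat_def)

text \<open>The equation contains second derivatives of w alone, in the pure directions xx and yy,
  so these two coefficients complete the second prolongation of \<open>F\<close>.\<close>

lemma pr_coeff_w_second:
  assumes "base j \<in> \<Omega>"
  shows "pr_coeff V Dep_w 2 0 j =
      - 2 * j (Jet Dep_w 2 0) * pdx A (plane j) - j (Jet Dep_w 1 0) * pdx (pdx A) (plane j)"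
    and "pr_coeff V Dep_w 0 2 j =
      - 2 * j (Jet Dep_w 1 1) * pdy A (plane j) - j (Jet Dep_w 1 0) * pdy (pdy A) (plane j)"
proof -
  note an = real_analytic_at_pdx[OF plane_analytic[OF assms]] real_analytic_at_pdy[OF plane_analytic[OF assms]]
  note simps = jet_field_minus jet_field_mult jet_field_coord
    jet_differentiable_mult jet_differentiable_coord jet_differentiable_plane jet_field_plane an
  \<comment> \<open>The recursion differentiates the first-order coefficient as a function; its
    closed form holds at all jets over \<Omega> and may therefore be substituted under the
    derivative.\<close>
  have 1: "jet_field 1 v (pr_coeff V Dep_w 1 0) j =
      jet_field 1 v (\<lambda>j. - j (Jet Dep_w 1 0) * pdx A (plane j)) j" for v
    by (rule jet_field_cong[OF open_\<Omega> assms]) (rule pr_coeff_first)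
  have 2: "jet_field 1 v (pr_coeff V Dep_w 0 1) j =
      jet_field 1 v (\<lambda>j. - j (Jet Dep_w 1 0) * pdy A (plane j)) j" for v
    by (rule jet_field_cong[OF open_\<Omega> assms]) (rule pr_coeff_first)
  have "total_dx 1 (pr_coeff V Dep_w 1 0) j =
      - j (Jet Dep_w 2 0) * pdx A (plane j) - j (Jet Dep_w 1 0) * pdx (pdx A) (plane j)"
    unfolding total_dx_eq_jet_field 1 by (simp add: simps numeral_2_eq_2)
  moreover have "pr_coeff V Dep_w 2 0 j = total_dx 1 (pr_coeff V Dep_w 1 0) j
      - j (Jet Dep_w 2 0) * total_dx 0 (\<lambda>j. xi V (base j)) j
      - j (Jet Dep_w 1 1) * total_dx 0 (\<lambda>j. eta V (base j)) j"
    by (simp add: numeral_2_eq_2)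
  ultimately show "pr_coeff V Dep_w 2 0 j =
      - 2 * j (Jet Dep_w 2 0) * pdx A (plane j) - j (Jet Dep_w 1 0) * pdx (pdx A) (plane j)"
    by (simp add: total_xi[OF assms] total_eta)
  have "total_dy 1 (pr_coeff V Dep_w 0 1) j =
      - j (Jet Dep_w 1 1) * pdy A (plane j) - j (Jet Dep_w 1 0) * pdy (pdy A) (plane j)"
    unfolding total_dy_eq_jet_field 2 by (simp add: simps numeral_2_eq_2)
  moreover have "pr_coeff V Dep_w 0 2 j = total_dy 1 (pr_coeff V Dep_w 0 1) j
      - j (Jet Dep_w 1 1) * total_dy 0 (\<lambda>j. xi V (base j)) j
      - j (Jet Dep_w 0 2) * total_dy 0 (\<lambda>j. eta V (base j)) j"
    by (simp add: numeral_2_eq_2)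
  ultimately show "pr_coeff V Dep_w 0 2 j =
      - 2 * j (Jet Dep_w 1 1) * pdy A (plane j) - j (Jet Dep_w 1 0) * pdy (pdy A) (plane j)"
    by (simp add: total_xi[OF assms] total_eta)
qed

lemma prolong_F:
  assumes "base j \<in> \<Omega>"
  shows "prolong 2 V F j =
    - j (Jet Dep_w 1 0) * pdx A (plane j) * j (Jet Dep_E 1 0)
    + j (Jet Dep_w 1 0) * (total_dx 0 \<psi>_jet j - j (Jet Dep_E 1 0) * pdx A (plane j))
    - j (Jet Dep_w 1 0) * pdy A (plane j) * j (Jet Dep_E 0 1)
    + j (Jet Dep_w 0 1) * (total_dy 0 \<psi>_jet j - j (Jet Dep_E 1 0) * pdy A (plane j))
    + \<psi> (base j) * (j (Jet Dep_w 2 0) + j (Jet Dep_w 0 2))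
    + j (Jet Dep_E 0 0) *
      (- 2 * j (Jet Dep_w 2 0) * pdx A (plane j) - j (Jet Dep_w 1 0) * pdx (pdx A) (plane j)
       - 2 * j (Jet Dep_w 1 1) * pdy A (plane j) - j (Jet Dep_w 1 0) * pdy (pdy A) (plane j))"
  unfolding prolong_eq_jet_field jet_field_F[OF order_refl] jet_coord.case
    pr_coeff_first[OF assms] pr_coeff_w_second[OF assms] pr_coeff.simps(1) coeff_V(2)
  by (simp add: algebra_simps)

text \<open>With \<phi> = 0 over \<Omega>, the derivative (A A_x + A_y) w_x of the coefficient in
  \<open>inv_surface\<close> cancels against the prolonged coefficients -A_x w_x and -A_y w_x,
  identically in the jet.\<close>

lemma prolong_\<phi>\<^sub>1:
  assumes "base j \<in> \<Omega>"
  shows "prolong 1 V (inv_surface V Dep_w) j = 0"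
  unfolding prolong_eq_jet_field jet_field_\<phi>\<^sub>1[OF assms order_refl] jet_coord.case
    pr_coeff_first[OF assms] xi_V[OF assms] eta_V
  by (simp add: algebra_simps)

text \<open>The A-terms cancel as they do for w. What is left is the difference between A D_x \<psi>
  + D_y \<psi> and the derivative of \<psi> along the field; these agree because A w_x + w_y = 0 and
  A E_x + E_y = \<psi> on the surface.\<close>

lemma prolong_\<phi>\<^sub>2:
  assumes "base j \<in> \<Omega>" "inv_surface V Dep_w j = 0" "inv_surface V Dep_E j = 0"
  shows "prolong 1 V (inv_surface V Dep_E) j = 0"
proof -
  define X Y W E where "X = jpd Coord_x \<psi>_jet j" and "Y = jpd Coord_y \<psi>_jet j"
    and "W = jpd (Jet Dep_w 0 0) \<psi>_jet j" and "E = jpd (Jet Dep_E 0 0) \<psi>_jet j"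
  have w: "j (Jet Dep_w 0 1) = - A (plane j) * j (Jet Dep_w 1 0)"
    and e: "\<psi> (base j) = A (plane j) * j (Jet Dep_E 1 0) + j (Jet Dep_E 0 1)"
    using assms by (simp_all add: inv_surface_def xi_V eta_V coeff_V)
  show ?thesis
    unfolding prolong_eq_jet_field jet_field_\<phi>\<^sub>2[OF assms(1) order_refl] jet_coord.case
      pr_coeff_first[OF assms(1)] xi_V[OF assms(1)] eta_V total_dx_eq_jet_field total_dy_eq_jet_field
      jet_field_base[of _ _ \<psi>] pr_coeff.simps(1) coeff_V(2) coeff_V(1)[OF assms(1)]
      X_def[symmetric] Y_def[symmetric] W_def[symmetric] E_def[symmetric]
    using w by (simp add: e algebra_simps)
qed

end

text \<open>The coefficient of \<open>w\<^sub>x E\<close> in \<open>pr\<^sup>2 U (F)\<close>, with \<open>P\<close>, \<open>Px\<close>, \<open>Py\<close> standing for \<open>\<psi> / E\<close> and its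
  derivatives.\<close>

lemma determining_equation:
  fixes a ax ay axx axy ayy P Px Py :: real
  assumes S: "(a\<^sup>2 + 1) * P = 2 * (ax - a * ay)"
    and X: "(a\<^sup>2 + 1) * Px + 2 * a * ax * P = 2 * (axx - ax * ay - a * axy)"
    and Y: "(a\<^sup>2 + 1) * Py + 2 * a * ay * P = 2 * (axy - ay\<^sup>2 - a * ayy)"
    and pde: "(a ^ 4 - 1) * axx + 4 * a * (a\<^sup>2 + 1) * axy - (a ^ 4 - 1) * ayy
      - 2 * a * (a\<^sup>2 - 3) * ax\<^sup>2 - 4 * (3 * a\<^sup>2 - 1) * ax * ay + 2 * a * (a\<^sup>2 - 3) * ay\<^sup>2 = 0"
  shows "Px - a * Py - a * P\<^sup>2 + (a * ax - 2 * ay) * P - axx + 2 * ax * ay - ayy = 0" (is "?Q = 0")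
proof -
  \<comment> \<open>The target is multiplied by \<open>n\<close> twice: one factor replaces
    \<open>Px\<close> and \<open>Py\<close> by second derivatives of A and a multiple of
    \<open>P\<close>, the other replaces every remaining \<open>P\<close>, so no division occurs
    before the last step.\<close>
  define n where "n = a\<^sup>2 + 1"
  have "n > 0" by (simp add: n_def add_nonneg_pos)
  have "n * n * ?Q
      = n * (n * Px) - a * n * (n * Py) - a * (n * P)\<^sup>2 + n * (a * ax - 2 * ay) * (n * P)
        - n * n * (axx - 2 * ax * ay + ayy)"
    by (simp add: algebra_simps power2_eq_square)
  also have "n * Px = 2 * (axx - ax * ay - a * axy) - 2 * a * ax * P"
    using X by (simp add: n_def)
  also have "n * Py = 2 * (axy - ay\<^sup>2 - a * ayy) - 2 * a * ay * P"
    using Y by (simp add: n_def)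
  also have "n * (2 * (axx - ax * ay - a * axy) - 2 * a * ax * P)
        - a * n * (2 * (axy - ay\<^sup>2 - a * ayy) - 2 * a * ay * P) - a * (n * P)\<^sup>2
        + n * (a * ax - 2 * ay) * (n * P) - n * n * (axx - 2 * ax * ay + ayy)
      = 2 * n * (axx - ax * ay - a * axy) - 2 * a * ax * (n * P)
        - 2 * a * n * (axy - ay\<^sup>2 - a * ayy) + 2 * a\<^sup>2 * ay * (n * P) - a * (n * P)\<^sup>2
        + n * (a * ax - 2 * ay) * (n * P) - n * n * (axx - 2 * ax * ay + ayy)"
    by (simp add: algebra_simps power2_eq_square)
  also have "n * P = 2 * (ax - a * ay)" using S by (simp add: n_def)
  also have "2 * n * (axx - ax * ay - a * axy) - 2 * a * ax * (2 * (ax - a * ay))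
        - 2 * a * n * (axy - ay\<^sup>2 - a * ayy) + 2 * a\<^sup>2 * ay * (2 * (ax - a * ay))
        - a * (2 * (ax - a * ay))\<^sup>2
        + n * (a * ax - 2 * ay) * (2 * (ax - a * ay)) - n * n * (axx - 2 * ax * ay + ayy)
      = - ((a ^ 4 - 1) * axx + 4 * a * (a\<^sup>2 + 1) * axy - (a ^ 4 - 1) * ayy
      - 2 * a * (a\<^sup>2 - 3) * ax\<^sup>2 - 4 * (3 * a\<^sup>2 - 1) * ax * ay + 2 * a * (a\<^sup>2 - 3) * ay\<^sup>2)"
    unfolding n_def by algebra
  finally have "n * n * ?Q = 0" by (simp only: pde minus_zero)
  thus ?thesis using \<open>n > 0\<close> by simp
qed

section \<open>The factor 2 (A_x - A A_y) / (A^2 + 1) and its derivatives\<close>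

definition \<psi>_factor :: "(real \<times> real \<Rightarrow> real) \<Rightarrow> real \<times> real \<Rightarrow> real" where
  "\<psi>_factor A p = 2 * (pdx A p - A p * pdy A p) / (A p ^ 2 + 1)"

lemma square_plus_one_nonzero: "(a :: real)\<^sup>2 + 1 \<noteq> 0"
  by (metis add.commute sum_power2_eq_zero_iff one_power2 zero_neq_one)

lemma real_analytic_at_\<psi>_factor:
  assumes "real_analytic_at A p"
  shows "real_analytic_at (\<psi>_factor A) p"
proof -
  have "real_analytic_at (\<lambda>p. 2 * (pdx A p - A p * pdy A p) * inverse (A p * A p + 1)) p"
    using square_plus_one_nonzero[of "A p"]
    by (intro real_analytic_at_mult real_analytic_at_diff real_analytic_at_inverse real_analytic_at_add
        real_analytic_at_const real_analytic_at_pdx real_analytic_at_pdy assms)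
       (simp add: power2_eq_square)
  thus ?thesis by (simp add: \<psi>_factor_def[abs_def] divide_inverse power2_eq_square)
qed

text \<open>Both follow by differentiating the product identity (A^2 + 1) P = 2 (A_x - A A_y) and
  comparing derivatives. Differentiability of P is known from analyticity, so the quotient itself is
  never differentiated.\<close>

lemma
  assumes "real_analytic_at A p"
  shows pdx_\<psi>_factor: "((A p)\<^sup>2 + 1) * pdx (\<psi>_factor A) p + 2 * A p * pdx A p * \<psi>_factor A p
      = 2 * (pdx (pdx A) p - pdx A p * pdy A p - A p * pdx (pdy A) p)"
    and pdy_\<psi>_factor: "((A p)\<^sup>2 + 1) * pdy (\<psi>_factor A) p + 2 * A p * pdy A p * \<psi>_factor A p
      = 2 * (pdy (pdx A) p - (pdy A p)\<^sup>2 - A p * pdy (pdy A) p)"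
proof -
  obtain x y where p: "p = (x, y)" by (cases p)
  have an: "real_analytic_at A (x, y)" "real_analytic_at (pdx A) (x, y)" "real_analytic_at (pdy A) (x, y)"
    "real_analytic_at (\<psi>_factor A) (x, y)"
    using assms real_analytic_at_pdx real_analytic_at_pdy real_analytic_at_\<psi>_factor by (auto simp: p)
  have eq: "((A q)\<^sup>2 + 1) * \<psi>_factor A q = 2 * (pdx A q - A q * pdy A q)" for q
    using square_plus_one_nonzero[of "A q"] by (simp add: \<psi>_factor_def)
  note dx = an[THEN has_real_derivative_pdx] and dy = an[THEN has_real_derivative_pdy]
  have L: "((\<lambda>t. ((A (t, y))\<^sup>2 + 1) * \<psi>_factor A (t, y)) has_real_derivative
      2 * A (x, y) * pdx A (x, y) * \<psi>_factor A (x, y) + ((A (x, y))\<^sup>2 + 1) * pdx (\<psi>_factor A) (x, y)) (at x)"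
    by (rule derivative_eq_intros dx refl)+ (simp add: algebra_simps)
  have R: "((\<lambda>t. 2 * (pdx A (t, y) - A (t, y) * pdy A (t, y))) has_real_derivative
      2 * (pdx (pdx A) (x, y) - (pdx A (x, y) * pdy A (x, y) + A (x, y) * pdx (pdy A) (x, y)))) (at x)"
    by (rule derivative_eq_intros dx refl)+ (simp add: algebra_simps)
  show "((A p)\<^sup>2 + 1) * pdx (\<psi>_factor A) p + 2 * A p * pdx A p * \<psi>_factor A p
      = 2 * (pdx (pdx A) p - pdx A p * pdy A p - A p * pdx (pdy A) p)"
    using DERIV_unique[OF L[unfolded eq] R] by (simp add: p algebra_simps)
  have L: "((\<lambda>t. ((A (x, t))\<^sup>2 + 1) * \<psi>_factor A (x, t)) has_real_derivative
      2 * A (x, y) * pdy A (x, y) * \<psi>_factor A (x, y) + ((A (x, y))\<^sup>2 + 1) * pdy (\<psi>_factor A) (x, y)) (at y)"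
    by (rule derivative_eq_intros dy refl)+ (simp add: algebra_simps)
  have R: "((\<lambda>t. 2 * (pdx A (x, t) - A (x, t) * pdy A (x, t))) has_real_derivative
      2 * (pdy (pdx A) (x, y) - (pdy A (x, y) * pdy A (x, y) + A (x, y) * pdy (pdy A) (x, y)))) (at y)"
    by (rule derivative_eq_intros dy refl)+ (simp add: algebra_simps)
  show "((A p)\<^sup>2 + 1) * pdy (\<psi>_factor A) p + 2 * A p * pdy A p * \<psi>_factor A p
      = 2 * (pdy (pdx A) p - (pdy A p)\<^sup>2 - A p * pdy (pdy A) p)"
    using DERIV_unique[OF L[unfolded eq] R] by (simp add: p algebra_simps power2_eq_square)
qed

section \<open>Uniqueness and existence of the coefficient of E\<close>

context generator_setting
begin

lemma total_inv_surface:
  assumes "base j \<in> \<Omega>"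
  shows "total_dx 1 (inv_surface V Dep_w) j =
      pdx A (plane j) * j (Jet Dep_w 1 0) + A (plane j) * j (Jet Dep_w 2 0) + j (Jet Dep_w 1 1)"
    and "total_dy 1 (inv_surface V Dep_w) j =
      pdy A (plane j) * j (Jet Dep_w 1 0) + A (plane j) * j (Jet Dep_w 1 1) + j (Jet Dep_w 0 2)"
    and "total_dx 1 (inv_surface V Dep_E) j = pdx A (plane j) * j (Jet Dep_E 1 0)
      + A (plane j) * j (Jet Dep_E 2 0) + j (Jet Dep_E 1 1) - total_dx 1 \<psi>_jet j"
    and "total_dy 1 (inv_surface V Dep_E) j = pdy A (plane j) * j (Jet Dep_E 1 0)
      + A (plane j) * j (Jet Dep_E 1 1) + j (Jet Dep_E 0 2) - total_dy 1 \<psi>_jet j"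
  unfolding total_dx_eq_jet_field total_dy_eq_jet_field
    jet_field_\<phi>\<^sub>1[OF assms order_refl] jet_field_\<phi>\<^sub>2[OF assms order_refl]
  by (simp_all add: numeral_2_eq_2)

text \<open>One test jet over each base point suffices: all derivatives of \<psi> in the prolonged
  equation carry a factor w_x or w_y, so at w_x = 0 the condition is linear and algebraic in the
  value of \<psi> at that point.\<close>

lemma \<psi>_unique:
  assumes gen: "nonclassical_generator \<Omega> \<xi> \<phi> \<psi>" and p: "(x, y, w, E) \<in> \<Omega>" and "E \<noteq> 0"
  shows "\<psi> (x, y, w, E) = \<psi>_factor A (x, y) * E"
proof -
  define a where "a = A (x, y)"
  \<comment> \<open>The value of w_xx forced by F = 0: with vanishing w_x and w_y, the surface gives
    w_yy = a^2 w_xx, and the equation becomes E (a^2 + 1) u = -1.\<close>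
  define u where "u = - 1 / (E * (a\<^sup>2 + 1))"
  \<comment> \<open>The total derivatives D_x \<psi> and D_y \<psi> at the test jet, where w_x = w_y
    = E_x = 0 and E_y = \<psi>. They involve no second-order coordinate, so E_xy and E_yy can be set
    from them without circularity.\<close>
  define r s where "r = deriv (\<lambda>t. \<psi> (t, y, w, E)) x"
    and "s = deriv (\<lambda>t. \<psi> (x, t, w, E)) y + \<psi> (x, y, w, E) * deriv (\<lambda>t. \<psi> (x, y, w, t)) E"
  \<comment> \<open>the jet with \<open>w\<^sub>x = E\<^sub>x = E\<^sub>x\<^sub>x = 0\<close> that satisfies all constraints\<close>
  define j :: jet where "j = (\<lambda>_. 0)(Coord_x := x, Coord_y := y,
      Jet Dep_w 0 0 := w, Jet Dep_w 2 0 := u, Jet Dep_w 1 1 := - a * u, Jet Dep_w 0 2 := a\<^sup>2 * u,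
      Jet Dep_E 0 0 := E, Jet Dep_E 0 1 := \<psi> (x, y, w, E), Jet Dep_E 1 1 := r, Jet Dep_E 0 2 := s - a * r)"
  have base: "base j = (x, y, w, E)" and plane: "plane j = (x, y)"
    by (simp_all add: j_def base_def plane_def)
  have j\<Omega>: "base j \<in> \<Omega>" using p base by simp
  have dx: "total_dx 1 \<psi>_jet j = r" and dy: "total_dy 1 \<psi>_jet j = s"
    unfolding total_dx_eq_jet_field total_dy_eq_jet_field jet_field_base
    by (simp_all add: jpd_def base_def j_def r_def s_def)
  have "E * (a\<^sup>2 + 1) \<noteq> 0" using \<open>E \<noteq> 0\<close> square_plus_one_nonzero[of a] by simp
  hence u: "E * (a\<^sup>2 + 1) * u = - 1" by (simp add: u_def)
  have "F j = 0" using u by (simp add: F_def j_def algebra_simps)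
  moreover have "inv_surface V Dep_w j = 0" "inv_surface V Dep_E j = 0"
    using xi_V[OF j\<Omega>] coeff_V(1)[OF j\<Omega>]
    by (simp_all add: inv_surface_def eta_V coeff_V(2) base) (simp_all add: j_def)
  moreover have "total_dx 1 (inv_surface V Dep_w) j = 0" "total_dy 1 (inv_surface V Dep_w) j = 0"
    "total_dx 1 (inv_surface V Dep_E) j = 0" "total_dy 1 (inv_surface V Dep_E) j = 0"
    unfolding total_inv_surface[OF j\<Omega>] dx dy plane
    by (simp_all add: j_def a_def power2_eq_square)
  ultimately have "prolong 2 V F j = 0"
    using gen j\<Omega> by (simp add: nonclassical_generator_def Let_def)
  hence "(a\<^sup>2 + 1) * u * \<psi> (x, y, w, E) = 2 * (pdx A (x, y) - a * pdy A (x, y)) * E * u"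
    unfolding prolong_F[OF j\<Omega>] base plane by (simp add: j_def algebra_simps)
  moreover have "u \<noteq> 0" using u by auto
  ultimately have "(a\<^sup>2 + 1) * \<psi> (x, y, w, E) = 2 * (pdx A (x, y) - a * pdy A (x, y)) * E"
    by (simp add: mult_ac)
  thus ?thesis
    using square_plus_one_nonzero[of a] by (simp add: \<psi>_factor_def a_def field_simps)
qed

lemma generator_\<psi>_factor:
  assumes \<psi>_eq: "\<And>x y w E. (x, y, w, E) \<in> \<Omega> \<Longrightarrow> \<psi> (x, y, w, E) = \<psi>_factor A (x, y) * E"
    and pde: "\<And>x y w E p. (x, y, w, E) \<in> \<Omega> \<Longrightarrow> p = (x, y) \<Longrightarrow>
      (A p ^ 4 - 1) * pdx (pdx A) p
      + 4 * A p * (A p ^ 2 + 1) * pdy (pdx A) p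
      - (A p ^ 4 - 1) * pdy (pdy A) p
      - 2 * A p * (A p ^ 2 - 3) * pdx A p ^ 2
      - 4 * (3 * A p ^ 2 - 1) * pdx A p * pdy A p
      + 2 * A p * (A p ^ 2 - 3) * pdy A p ^ 2 = 0"
    and analytic: "real_analytic_on \<xi> \<Omega>" "real_analytic_on \<phi> \<Omega>"
  shows "nonclassical_generator \<Omega> \<xi> \<phi> \<psi>"
proof -
  have "prolong 2 V F j = 0"
    if j\<Omega>: "base j \<in> \<Omega>"
      and surf: "inv_surface V Dep_w j = 0" "inv_surface V Dep_E j = 0"
      and tot: "total_dx 1 (inv_surface V Dep_w) j = 0" "total_dy 1 (inv_surface V Dep_w) j = 0" for j
  proof -
    define a ax ay P Px Py where "a = A (plane j)" and "ax = pdx A (plane j)" and "ay = pdy A (plane j)"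
      and "P = \<psi>_factor A (plane j)" and "Px = pdx (\<psi>_factor A) (plane j)"
      and "Py = pdy (\<psi>_factor A) (plane j)"
    define axx axy ayy where "axx = pdx (pdx A) (plane j)" and "axy = pdy (pdx A) (plane j)"
      and "ayy = pdy (pdy A) (plane j)"
    note defs = a_def ax_def ay_def P_def Px_def Py_def axx_def axy_def ayy_def
    define w1 w2 e1 e where "w1 = j (Jet Dep_w 1 0)" and "w2 = j (Jet Dep_w 2 0)"
      and "e1 = j (Jet Dep_E 1 0)" and "e = j (Jet Dep_E 0 0)"
    note an = plane_analytic[OF j\<Omega>]
    have \<psi>j: "\<psi> (base j) = \<psi>_factor A (plane j) * j (Jet Dep_E 0 0)" if "base j \<in> \<Omega>" for j
      using \<psi>_eq that by (simp add: base_def plane_def)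
    have field: "jet_field 0 v \<psi>_jet j = (v Coord_x * Px + v Coord_y * Py) * e + P * v (Jet Dep_E 0 0)" for v
    proof -
      have "jet_field 0 v \<psi>_jet j = jet_field 0 v (\<lambda>j. \<psi>_factor A (plane j) * j (Jet Dep_E 0 0)) j"
        by (rule jet_field_cong[OF open_\<Omega> j\<Omega> \<psi>j])
      thus ?thesis
        using jet_differentiable_plane[OF real_analytic_at_\<psi>_factor[OF an]]
          jet_field_plane[OF real_analytic_at_\<psi>_factor[OF an]]
        by (simp add: jet_field_mult jet_field_coord jet_differentiable_coord defs e_def)
    qed
    have td: "total_dx 0 \<psi>_jet j = Px * e + P * e1" "total_dy 0 \<psi>_jet j = Py * e + P * j (Jet Dep_E 0 1)"
      unfolding total_dx_eq_jet_field total_dy_eq_jet_field field by (simp_all add: e1_def)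
    have w01: "j (Jet Dep_w 0 1) = - a * w1" and e01: "j (Jet Dep_E 0 1) = P * e - a * e1"
      using surf xi_V[OF j\<Omega>] coeff_V(1)[OF j\<Omega>] \<psi>j[OF j\<Omega>]
      by (simp_all add: inv_surface_def eta_V coeff_V(2) defs w1_def e1_def e_def algebra_simps)
    \<comment> \<open>The differentiated surface condition for w leaves w_x and w_xx free. As
      \<open>F\<close> is of first order in E, the remaining parameters are E_x and E.\<close>
    have w11: "j (Jet Dep_w 1 1) = - ax * w1 - a * w2"
      using tot(1) unfolding total_inv_surface[OF j\<Omega>] by (simp add: defs w1_def w2_def)
    have w02: "j (Jet Dep_w 0 2) = - ay * w1 - a * (- ax * w1 - a * w2)"
      using tot(2) w11 unfolding total_inv_surface[OF j\<Omega>] by (simp add: defs w1_def w2_def)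
    have S: "(a\<^sup>2 + 1) * P = 2 * (ax - a * ay)"
      using square_plus_one_nonzero[of a] by (simp add: \<psi>_factor_def defs)
    have Q: "Px - a * Py - a * P\<^sup>2 + (a * ax - 2 * ay) * P - axx + 2 * ax * ay - ayy = 0"
    proof (rule determining_equation[OF S])
      \<comment> \<open>Differentiating A A_y in x yields \<open>pdx (pdy A)\<close>, whereas
        \<open>axy\<close> is \<open>pdy (pdx A)\<close> as in the assumed equation; this is where
        commutation enters.\<close>
      show "(a\<^sup>2 + 1) * Px + 2 * a * ax * P = 2 * (axx - ax * ay - a * axy)"
        using pdx_\<psi>_factor[OF an] pdx_pdy_commute[OF an] by (simp add: defs)
      show "(a\<^sup>2 + 1) * Py + 2 * a * ay * P = 2 * (axy - ay\<^sup>2 - a * ayy)"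
        using pdy_\<psi>_factor[OF an] by (simp add: defs)
      show "(a ^ 4 - 1) * axx + 4 * a * (a\<^sup>2 + 1) * axy - (a ^ 4 - 1) * ayy
        - 2 * a * (a\<^sup>2 - 3) * ax\<^sup>2 - 4 * (3 * a\<^sup>2 - 1) * ax * ay + 2 * a * (a\<^sup>2 - 3) * ay\<^sup>2 = 0"
        unfolding defs by (rule pde[of _ _ "j (Jet Dep_w 0 0)" "j (Jet Dep_E 0 0)"])
          (use j\<Omega> in \<open>simp_all add: base_def plane_def\<close>)
    qed
    \<comment> \<open>After elimination the polynomial splits into two multiples: one of the
      relation that defines P, the other of the determining expression. Both vanish
      separately.\<close>
    have "prolong 2 V F j =
        (e * w2 + w1 * e1) * ((a\<^sup>2 + 1) * P - 2 * (ax - a * ay))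
        + w1 * e * (Px - a * Py - a * P\<^sup>2 + (a * ax - 2 * ay) * P - axx + 2 * ax * ay - ayy)"
      unfolding prolong_F[OF j\<Omega>] td w01 e01 w11 w02 \<psi>j[OF j\<Omega>] defs[symmetric]
        w1_def[symmetric] w2_def[symmetric] e1_def[symmetric] e_def[symmetric]
      by (simp add: algebra_simps power2_eq_square)
    thus "prolong 2 V F j = 0" by (simp add: S Q)
  qed
  thus ?thesis
    unfolding nonclassical_generator_def Let_def
    using analytic \<psi> prolong_\<phi>\<^sub>1 prolong_\<phi>\<^sub>2 by blast
qed

end

theorem proposition6:
  fixes A :: "real \<times> real \<Rightarrow> real"
    and G :: "real \<times> real \<times> real \<Rightarrow> real"
    and D :: "(real \<times> real) set"
    and \<Omega> :: "point set"
  assumes "open D" and "open \<Omega>"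
    and "\<And>x y w E. (x, y, w, E) \<in> \<Omega> \<Longrightarrow> (x, y) \<in> D \<and> E \<noteq> 0"
    and "real_analytic_on A D"
    and "\<exists>p\<in>D. A p \<noteq> 0"
    and "\<And>p. p \<in> D \<Longrightarrow>
      (A p ^ 4 - 1) * pdx (pdx A) p
      + 4 * A p * (A p ^ 2 + 1) * pdy (pdx A) p
      - (A p ^ 4 - 1) * pdy (pdy A) p
      - 2 * A p * (A p ^ 2 - 3) * pdx A p ^ 2
      - 4 * (3 * A p ^ 2 - 1) * pdx A p * pdy A p
      + 2 * A p * (A p ^ 2 - 3) * pdy A p ^ 2 = 0"
    and "\<And>x y w E. (x, y, w, E) \<in> \<Omega> \<Longrightarrow> G (x, y, w) = 0"
  defines "\<psi>\<^sub>0 \<equiv> (\<lambda>(x, y, w, E).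
      2 * (pdx A (x, y) - A (x, y) * pdy A (x, y)) / (A (x, y) ^ 2 + 1) * E)"
  shows "nonclassical_generator \<Omega> (\<lambda>(x, y, w, E). A (x, y)) (\<lambda>(x, y, w, E). G (x, y, w)) \<psi>\<^sub>0 \<and>
    (\<forall>\<xi> \<phi> \<psi>. nonclassical_generator \<Omega> \<xi> \<phi> \<psi> \<and>
        (\<forall>(x, y, w, E)\<in>\<Omega>. \<xi> (x, y, w, E) = A (x, y) \<and> \<phi> (x, y, w, E) = G (x, y, w)) \<longrightarrow>
      (\<forall>p\<in>\<Omega>. \<psi> p = \<psi>\<^sub>0 p))"
proof (intro conjI allI impI)
  have A_an: "real_analytic_at A (x, y)" if "(x, y, w, E) \<in> \<Omega>" for x y w E
    using assms(3)[OF that] assms(4) by (simp add: real_analytic_on_def)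
  \<comment> \<open>\<open>G\<close> is known to vanish only over \<Omega>; openness of \<Omega>
    makes it locally equal to a constant at each point there.\<close>
  have zero: "real_analytic_on \<phi> \<Omega>" if "\<And>p. p \<in> \<Omega> \<Longrightarrow> \<phi> p = 0" for \<phi> :: "point \<Rightarrow> real"
    unfolding real_analytic_on_def
    using real_analytic_at_cong[OF real_analytic_at_const assms(2)] that by metis
  have pull: "real_analytic_at (\<lambda>(x, y, w, E). B (x, y)) p"
    if "real_analytic_at B (fst p, fst (snd p))" for B :: "real \<times> real \<Rightarrow> real" and p :: point
    using real_analytic_at_plane[OF that] by (simp add: case_prod_unfold)
  have \<xi>_an: "real_analytic_on (\<lambda>(x, y, w, E). A (x, y)) \<Omega>"
    unfolding real_analytic_on_def using A_an by (auto intro!: pull)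
  have \<psi>\<^sub>0_eq: "\<psi>\<^sub>0 (x, y, w, E) = \<psi>_factor A (x, y) * E" for x y w E
    by (simp add: \<psi>\<^sub>0_def \<psi>_factor_def)
  have \<psi>\<^sub>0_an: "real_analytic_on \<psi>\<^sub>0 \<Omega>"
    unfolding real_analytic_on_def
  proof
    fix p assume "p \<in> \<Omega>"
    \<comment> \<open>Writing E as an inner product with a basis vector turns
      \<open>\<psi>\<^sub>0\<close> into the product of a pulled-back function of (x, y) and a
      coordinate function.\<close>
    hence "real_analytic_at (\<lambda>p. (\<lambda>(x, y, w, E). \<psi>_factor A (x, y)) p * (p \<bullet> (0, 0, 0, 1))) p"
      using A_an
      by (intro real_analytic_at_mult pull real_analytic_at_\<psi>_factor real_analytic_at_coordinate
          Basis_point) (metis prod.collapse)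
    moreover have "(\<lambda>p. (\<lambda>(x, y, w, E). \<psi>_factor A (x, y)) p * (p \<bullet> (0, 0, 0, 1))) = \<psi>\<^sub>0"
      by (auto simp: fun_eq_iff \<psi>\<^sub>0_eq inner_prod_def)
    ultimately show "real_analytic_at \<psi>\<^sub>0 p" by simp
  qed
  have setting: "generator_setting A \<Omega> \<xi> \<phi> \<psi>"
    if "\<forall>(x, y, w, E)\<in>\<Omega>. \<xi> (x, y, w, E) = A (x, y) \<and> \<phi> (x, y, w, E) = G (x, y, w)"
      "real_analytic_on \<psi> \<Omega>" for \<xi> \<phi> \<psi>
    by unfold_locales (use assms(2,7) A_an that in fastforce)+
  show "nonclassical_generator \<Omega> (\<lambda>(x, y, w, E). A (x, y)) (\<lambda>(x, y, w, E). G (x, y, w)) \<psi>\<^sub>0"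
  proof (rule generator_setting.generator_\<psi>_factor)
    show "generator_setting A \<Omega> (\<lambda>(x, y, w, E). A (x, y)) (\<lambda>(x, y, w, E). G (x, y, w)) \<psi>\<^sub>0"
      by (rule setting) (use \<psi>\<^sub>0_an in auto)
    show "real_analytic_on (\<lambda>(x, y, w, E). G (x, y, w)) \<Omega>"
      by (rule zero) (use assms(7) in auto)
  qed (use \<psi>\<^sub>0_eq assms(3,6) \<xi>_an in blast)+
  fix \<xi> \<phi> \<psi>
  assume gen: "nonclassical_generator \<Omega> \<xi> \<phi> \<psi> \<and>
    (\<forall>(x, y, w, E)\<in>\<Omega>. \<xi> (x, y, w, E) = A (x, y) \<and> \<phi> (x, y, w, E) = G (x, y, w))"
  then interpret generator_setting A \<Omega> \<xi> \<phi> \<psi>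
    by (intro setting) (auto simp: nonclassical_generator_def)
  show "\<forall>p\<in>\<Omega>. \<psi> p = \<psi>\<^sub>0 p"
    using \<psi>_unique gen assms(3) \<psi>\<^sub>0_eq by auto
qed

end
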